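(* The bivariate complex Hermite polynomials $H_{m,n,m',n'}$, $m,n,m',n'=0,1,2,\dots$, form an orthogonal basis (a complete orthogonal system) of the Hilbert space $L^2(\mathbb{C}^2,e^{-2(|z|^2+|w|^2)}d\lambda)$.
   Context: For integers $m,n\ge 0$ and $\zeta\in\mathbb{C}$, the univariate complex Hermite polynomials are $H_{m,n}(\zeta,\overline{\zeta})=(-1)^{m+n}e^{|\zeta|^2}\frac{\partial^{m+n}}{\partial\overline{\zeta}^{m}\partial\zeta^{n}}\left(e^{-|\zeta|^2}\right)$ (Wirtinger derivatives). For $m,n,m',n'\ge 0$ and $(z,w)\in\mathbb{C}^2$, the bivariate complex Hermite polynomials are $H_{m,n,m',n'}(z,w)=H_{m,n}(z+iw,\overline{z}-i\overline{w})\,H_{m',n'}(\overline{z}+i\overline{w},z-iw)$. (Note $\overline{z}-i\overline{w}$ is the complex conjugate of $z+iw$ and $z-iw$ is the complex conjugate of $\overline{z}+i\overline{w}$.) $d\lambda$ is Lebesgue measure on $\mathbb{C}^2=\mathbb{R}^4$. *)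

theory Defs
  imports "HOL-Analysis.Analysis"
begin

definition wirtinger :: "(complex \<Rightarrow> complex) \<Rightarrow> complex \<Rightarrow> complex" where
  "wirtinger f \<zeta> =
     (vector_derivative (\<lambda>x::real. f (\<zeta> + of_real x)) (at 0)
      - \<i> * vector_derivative (\<lambda>y::real. f (\<zeta> + \<i> * of_real y)) (at 0)) / 2"

definition wirtinger_bar :: "(complex \<Rightarrow> complex) \<Rightarrow> complex \<Rightarrow> complex" where
  "wirtinger_bar f \<zeta> =
     (vector_derivative (\<lambda>x::real. f (\<zeta> + of_real x)) (at 0)
      + \<i> * vector_derivative (\<lambda>y::real. f (\<zeta> + \<i> * of_real y)) (at 0)) / 2"

text \<open>The second argument of \<open>H\<^sub>m\<^sub>,\<^sub>n(\<zeta>, cnj \<zeta>)\<close> is always the conjugate of the first,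
  so the polynomial is represented as a function of \<open>\<zeta>\<close> alone.\<close>

definition complex_hermite :: "nat \<Rightarrow> nat \<Rightarrow> complex \<Rightarrow> complex" where
  "complex_hermite m n \<zeta> =
     (-1) ^ (m + n) * of_real (exp ((cmod \<zeta>)\<^sup>2)) *
     (wirtinger_bar ^^ m) ((wirtinger ^^ n) (\<lambda>\<xi>. of_real (exp (- (cmod \<xi>)\<^sup>2)))) \<zeta>"

definition bivariate_hermite ::
    "nat \<Rightarrow> nat \<Rightarrow> nat \<Rightarrow> nat \<Rightarrow> complex \<times> complex \<Rightarrow> complex" where
  "bivariate_hermite m n m' n' =
     (\<lambda>(z, w). complex_hermite m n (z + \<i> * w) * complex_hermite m' n' (cnj z + \<i> * cnj w))"

definition gauss_measure :: "(complex \<times> complex) measure" where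
  "gauss_measure =
     density lborel (\<lambda>(z, w). ennreal (exp (- 2 * ((cmod z)\<^sup>2 + (cmod w)\<^sup>2))))"

text \<open>Elements of \<open>L\<^sup>2\<close> are represented by square-integrable functions rather than by their
  classes modulo equality almost everywhere; \<open>L2_norm\<close> is accordingly a seminorm, and an
  element is nonzero in \<open>L\<^sup>2\<close> iff its \<open>L2_norm\<close> is nonzero.\<close>

definition L2_space :: "'a measure \<Rightarrow> ('a \<Rightarrow> complex) set" where
  "L2_space M = {f \<in> borel_measurable M. integrable M (\<lambda>x. (cmod (f x))\<^sup>2)}"

definition L2_inner :: "'a measure \<Rightarrow> ('a \<Rightarrow> complex) \<Rightarrow> ('a \<Rightarrow> complex) \<Rightarrow> complex" where
  "L2_inner M f g = (LINT x|M. f x * cnj (g x))"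

definition L2_norm :: "'a measure \<Rightarrow> ('a \<Rightarrow> complex) \<Rightarrow> real" where
  "L2_norm M f = sqrt (LINT x|M. (cmod (f x))\<^sup>2)"

text \<open>An orthogonal basis of the Hilbert space \<open>L\<^sup>2(M)\<close>: nonzero, pairwise orthogonal elements
  whose finite linear combinations are dense.\<close>

definition L2_orthogonal_basis :: "'a measure \<Rightarrow> ('i \<Rightarrow> 'a \<Rightarrow> complex) \<Rightarrow> bool" where
  "L2_orthogonal_basis M \<phi> \<longleftrightarrow>
     (\<forall>i. \<phi> i \<in> L2_space M \<and> L2_norm M (\<phi> i) \<noteq> 0) \<and>
     (\<forall>i j. i \<noteq> j \<longrightarrow> L2_inner M (\<phi> i) (\<phi> j) = 0) \<and>
     (\<forall>f \<in> L2_space M. \<forall>\<epsilon>>0. \<exists>F c. finite F \<and>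
        L2_norm M (\<lambda>x. f x - (\<Sum>i\<in>F. c i * \<phi> i x)) < \<epsilon>)"

end

theory Submission
  imports "HOL-Probability.Distributions" Defs
begin

text \<open>With \<open>u = z + \<i>w\<close> and \<open>v = cnj z + \<i> cnj w\<close> one has \<open>|u|\<^sup>2 + |v|\<^sup>2 = 2(|z|\<^sup>2 + |w|\<^sup>2)\<close>, so the weight
  factors. Orthogonality needs only two facts. By the Rodrigues formula every weighted
  Hermite function other than the Gaussian itself is a derivative and so has integral zero; and the
  recurrences for multiplication by \<open>u, cnj u, v, cnj v\<close> reduce every inner product to such
  integrals. The recurrences also show that the span is closed under multiplication by linear forms,
  so it contains all polynomials. By Taylor expansion its \<open>L\<^sup>2\<close>-closure contains all
  \<open>cos (x \<bullet> \<xi> + c)\<close>. The smallest class of functions containing these and closed under sums,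
  scalars and bounded pointwise limits is an algebra, so it contains the indicators of half-spaces
  and hence of all Borel sets; simple functions then give all of \<open>L\<^sup>2\<close>.\<close>

subsection \<open>Bounded pointwise limits of trigonometric polynomials\<close>

text \<open>The limits are pointwise everywhere and uniformly bounded, so the class mentions no
  measure and yet dominated convergence applies to it for every finite measure. The free phase
  \<open>c\<close> covers sines and constants along with cosines.\<close>

inductive trig_closure :: "('a::euclidean_space \<Rightarrow> real) \<Rightarrow> bool" where
  cos: "trig_closure (\<lambda>x. cos (x \<bullet> \<xi> + c))"
| add: "trig_closure f \<Longrightarrow> trig_closure g \<Longrightarrow> trig_closure (\<lambda>x. f x + g x)"
| scale: "trig_closure f \<Longrightarrow> trig_closure (\<lambda>x. c * f x)"
| lim: "(\<And>n::nat. trig_closure (f n)) \<Longrightarrow> (\<And>n x. \<bar>f n x\<bar> \<le> C) \<Longrightarrow> (\<And>x. (\<lambda>n. f n x) \<longlonglongrightarrow> g x)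
    \<Longrightarrow> trig_closure g"

lemma trig_closure_const: "trig_closure (\<lambda>x. c)"
  using trig_closure.scale[OF trig_closure.cos[of 0 0], of c] by simp

lemma trig_closure_diff:
  assumes "trig_closure f" "trig_closure g"
  shows "trig_closure (\<lambda>x. f x - g x)"
  using trig_closure.add[OF assms(1) trig_closure.scale[OF assms(2), of "-1"]] by simp

text \<open>Supplies the uniform bound that rule \<open>lim\<close> demands when limits are
  multiplied by, or composed with, other functions.\<close>

lemma trig_closure_bounded:
  assumes "trig_closure f"
  obtains C where "\<And>x. \<bar>f x\<bar> \<le> C"
proof -
  have "\<exists>C. \<forall>x. \<bar>f x\<bar> \<le> C"
    using assms
  proof induction
    case (cos \<xi> c)
    then show ?case by (intro exI[of _ 1]) simp
  next
    case (add f g)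
    then obtain A B where "\<forall>x. \<bar>f x\<bar> \<le> A" "\<forall>x. \<bar>g x\<bar> \<le> B" by blast
    then show ?case
      by (intro exI[of _ "A + B"]) (meson abs_triangle_ineq add_mono order_trans)
  next
    case (scale f c)
    then obtain A where "\<forall>x. \<bar>f x\<bar> \<le> A" by blast
    then show ?case
      by (intro exI[of _ "\<bar>c\<bar> * A"]) (simp add: abs_mult mult_left_mono)
  next
    case (lim f C g)
    then have "\<bar>g x\<bar> \<le> C" for x
      by (intro LIMSEQ_le_const2[OF tendsto_rabs[OF lim(3)]]) auto
    then show ?case by blast
  qed
  with that show ?thesis by blast
qed

text \<open>Products of two cosines are sums of cosines. Induction on one factor extends this to a
  general function times a cosine, and a second induction, on the other factor, to two general
  functions.\<close>

lemma trig_closure_mult: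
  assumes "trig_closure f" "trig_closure g"
  shows "trig_closure (\<lambda>x. f x * g x)"
proof -
  \<comment> \<open>The induction common to both stages: for fixed \<open>g\<close>, it is enough to
    treat cosines as the other factor. It is used first with a cosine as \<open>g\<close>, then with
    the given \<open>g\<close>.\<close>
  have *: "trig_closure (\<lambda>x. f x * g x)"
    if g: "trig_closure g" and f: "trig_closure f"
      and cos: "\<And>\<xi> c. trig_closure (\<lambda>x. cos (x \<bullet> \<xi> + c) * g x)" for f g :: "'a \<Rightarrow> real"
    using f
  proof induction
    case (cos \<xi> c)
    then show ?case by (rule that(3))
  next
    case (add f h)
    from trig_closure.add[OF add.IH] show ?case by (simp add: algebra_simps)
  next
    case (scale f c)
    from trig_closure.scale[OF scale.IH] show ?case by (simp add: mult.assoc)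
  next
    case (lim f C h)
    obtain B where B: "\<And>x. \<bar>g x\<bar> \<le> B" using trig_closure_bounded[OF g] by blast
    have "\<bar>f n x * g x\<bar> \<le> C * B" for n x
      using lim(2)[of n x] B[of x] unfolding abs_mult
      by (intro mult_mono) auto
    moreover have "(\<lambda>n. f n x * g x) \<longlonglongrightarrow> h x * g x" for x
      by (intro tendsto_intros lim)
    ultimately show ?case by (rule trig_closure.lim[OF lim.IH])
  qed
  have "trig_closure (\<lambda>x. cos (x \<bullet> \<eta> + d) * cos (x \<bullet> \<xi> + c))" for \<xi> \<eta> :: 'a and c d
  proof -
    have "trig_closure (\<lambda>x. 1/2 * (cos (x \<bullet> (\<eta> - \<xi>) + (d - c)) + cos (x \<bullet> (\<eta> + \<xi>) + (d + c))))"
      by (intro trig_closure.intros)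
    moreover have "x \<bullet> (\<eta> - \<xi>) + (d - c) = (x \<bullet> \<eta> + d) - (x \<bullet> \<xi> + c)"
      "x \<bullet> (\<eta> + \<xi>) + (d + c) = (x \<bullet> \<eta> + d) + (x \<bullet> \<xi> + c)" for x
      by (simp_all add: inner_diff_right inner_add_right)
    ultimately show ?thesis
      unfolding cos_times_cos by simp
  qed
  then have "trig_closure (\<lambda>x. g x * cos (x \<bullet> \<xi> + c))" for \<xi> c
    by (rule *[OF trig_closure.cos assms(2)])
  then have "trig_closure (\<lambda>x. cos (x \<bullet> \<xi> + c) * g x)" for \<xi> c
    by (simp add: mult.commute)
  then show ?thesis by (rule *[OF assms(2,1)])
qed

text \<open>The range of \<open>f\<close> lies in some compact interval, where Weierstrass
  polynomials approximate \<open>\<phi>\<close> uniformly; polynomials in \<open>f\<close> stay in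
  the class because it is an algebra.\<close>

lemma trig_closure_continuous_compose:
  fixes \<phi> :: "real \<Rightarrow> real"
  assumes f: "trig_closure f" and cont: "continuous_on UNIV \<phi>"
  shows "trig_closure (\<lambda>x. \<phi> (f x))"
proof -
  have poly: "trig_closure (\<lambda>x. p (f x))" if "real_polynomial_function p" for p :: "real \<Rightarrow> real"
    using that
  proof induction
    case (linear p)
    then obtain c where "p = (\<lambda>x. x * c)" using real_bounded_linear by blast
    then show ?case using trig_closure.scale[OF f, of c] by (simp add: mult.commute)
  qed (auto intro: trig_closure_const trig_closure.add trig_closure_mult)
  obtain C where C: "\<And>x. \<bar>f x\<bar> \<le> C" using trig_closure_bounded[OF f] by blast
  have cont': "continuous_on {-C..C} \<phi>" using cont continuous_on_subset by blast
  have "\<exists>p. real_polynomial_function p \<and> (\<forall>x\<in>{-C..C}. \<bar>\<phi> x - p x\<bar> < 1 / Suc n)" for n :: nat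
    using Stone_Weierstrass_real_polynomial_function[OF compact_Icc cont', of "1 / Suc n"]
    by (metis of_nat_0_less_iff zero_less_Suc zero_less_divide_1_iff)
  then obtain p where p: "\<And>n::nat. real_polynomial_function (p n)"
    and close: "\<And>n x. x \<in> {-C..C} \<Longrightarrow> \<bar>\<phi> x - p n x\<bar> < 1 / Suc n"
    by metis
  have fC: "f x \<in> {-C..C}" for x using C[of x] by auto
  have "bounded (\<phi> ` {-C..C})"
    using compact_continuous_image[OF cont' compact_Icc] compact_imp_bounded by blast
  then obtain B where B: "\<And>x. x \<in> {-C..C} \<Longrightarrow> \<bar>\<phi> x\<bar> \<le> B"
    unfolding bounded_iff real_norm_def by blast
  have "\<bar>p n (f x)\<bar> \<le> B + 1" for n x
  proof -
    have "1 / Suc n \<le> (1::real)" by simp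
    then show ?thesis using close[OF fC, of x n] B[OF fC, of x] by linarith
  qed
  moreover have "(\<lambda>n. p n (f x)) \<longlonglongrightarrow> \<phi> (f x)" for x
  proof (rule LIMSEQ_I)
    fix r :: real assume "r > 0"
    then obtain N where N: "1 / Suc N < r" using nat_approx_posE by blast
    have "norm (p n (f x) - \<phi> (f x)) < r" if "n \<ge> N" for n
    proof -
      have "1 / Suc n \<le> 1 / Suc N" using that by (simp add: frac_le)
      then show ?thesis using close[OF fC, of x n] N by auto
    qed
    then show "\<exists>N. \<forall>n\<ge>N. norm (p n (f x) - \<phi> (f x)) < r" by blast
  qed
  ultimately show ?thesis by (rule trig_closure.lim[OF poly[OF p]])
qed

text \<open>The continuous ramps \<open>min 1 (max 0 (n * s))\<close> converge pointwise to the
  indicator of the positive reals and are bounded by 1.\<close>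

lemma trig_closure_indicator_pos:
  assumes f: "trig_closure f"
  shows "trig_closure (indicator {x. 0 < f x} :: _ \<Rightarrow> real)"
proof (rule trig_closure.lim)
  show "trig_closure (\<lambda>x. min 1 (max 0 (real n * f x)))" for n
    by (rule trig_closure_continuous_compose[OF f, where \<phi> = "\<lambda>s. min 1 (max 0 (real n * s))"])
       (auto intro!: continuous_intros)
  show "\<bar>min 1 (max 0 (real n * f x))\<bar> \<le> 1" for n x by simp
  show "(\<lambda>n. min 1 (max 0 (real n * f x))) \<longlonglongrightarrow> indicator {x. 0 < f x} x" for x
  proof (cases "0 < f x")
    case True
    have "eventually (\<lambda>n. min 1 (max 0 (real n * f x)) = 1) sequentially"
    proof -
      obtain N :: nat where N: "1 / f x < real N" using reals_Archimedean2 by blast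
      show ?thesis
        using eventually_ge_at_top[of N]
      proof eventually_elim
        case (elim n)
        have "1 / f x \<le> real n" using elim N by linarith
        then have "1 \<le> real n * f x" using True by (simp add: field_simps)
        then show ?case by simp
      qed
    qed
    then show ?thesis using True by (simp add: tendsto_eventually)
  next
    case False
    then have "real n * f x \<le> 0" for n
      by (simp add: mult_nonneg_nonpos)
    then have "min 1 (max 0 (real n * f x)) = 0" for n
      by (simp add: max_absorb1)
    then show ?thesis using False by simp
  qed
qed

text \<open>A nonzero linear form is unbounded, hence not in the class. The sine of
  \<open>(x \<bullet> b - a) / Suc n\<close> is in it, and for large \<open>n\<close> has the same
  sign as \<open>x \<bullet> b - a\<close>, so the indicators of its positivity sets converge to
  that of the half-space.\<close>

lemma trig_closure_indicator_halfspace: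
  "trig_closure (indicator {x. a < x \<bullet> b} :: 'a::euclidean_space \<Rightarrow> real)"
proof -
  define s where "s = (\<lambda>(n::nat) (x::'a). sin ((x \<bullet> b - a) / Suc n))"
  have sin: "trig_closure (s n)" for n
  proof -
    \<comment> \<open>The sine is a cosine with phase shifted by -pi/2.\<close>
    have "trig_closure (\<lambda>x. cos (x \<bullet> (b /\<^sub>R Suc n) + (- a / Suc n - pi / 2)))"
      by (rule trig_closure.cos)
    moreover have "cos (x \<bullet> (b /\<^sub>R Suc n) + (- a / Suc n - pi / 2)) = s n x" for x
    proof -
      have "x \<bullet> (b /\<^sub>R Suc n) + (- a / Suc n - pi / 2) = - (pi / 2 - (x \<bullet> b - a) / Suc n)"
      proof -
        have "x \<bullet> (b /\<^sub>R Suc n) = x \<bullet> b / Suc n"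
          by (simp add: divide_real_def)
        then show ?thesis by (simp only: diff_divide_distrib)
      qed
      then show ?thesis unfolding s_def by (simp only: cos_minus sin_cos_eq of_real_eq_id id_apply)
    qed
    ultimately show ?thesis by (simp add: fun_eq_iff)
  qed
  show ?thesis
  proof (rule trig_closure.lim[OF trig_closure_indicator_pos[OF sin]])
    show "\<bar>indicator {x. 0 < s n x} x :: real\<bar> \<le> 1" for n x by (simp add: indicator_def)
    show "(\<lambda>n. indicator {x. 0 < s n x} x) \<longlonglongrightarrow> (indicator {x. a < x \<bullet> b} x :: real)" for x
    proof (rule tendsto_eventually)
      obtain N :: nat where N: "\<bar>x \<bullet> b - a\<bar> < real N" using reals_Archimedean2 by blast
      show "\<forall>\<^sub>F n in sequentially. indicator {x. 0 < s n x} x = (indicator {x. a < x \<bullet> b} x :: real)"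
        using eventually_ge_at_top[of N]
      proof eventually_elim
        case (elim n)
        define t where "t = (x \<bullet> b - a) / Suc n"
        have "\<bar>x \<bullet> b - a\<bar> < Suc n" using elim N by linarith
        then have "\<bar>t\<bar> < 1" by (simp add: t_def abs_divide)
        then have t: "- pi < t" "t < pi" using pi_gt3 by auto
        have "0 < sin t \<longleftrightarrow> 0 < t"
          using t sin_gt_zero[of t] sin_gt_zero[of "- t"] by (cases t "0::real" rule: linorder_cases) auto
        moreover have "0 < t \<longleftrightarrow> a < x \<bullet> b" by (simp add: t_def zero_less_divide_iff)
        ultimately show ?case by (simp add: indicator_def s_def t_def)
      qed
    qed
  qed
qed

text \<open>Since products are available, finite unions follow from inclusion-exclusion; complements
  and increasing limits then make the sets with indicator in the class a sigma-algebra containing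
  the half-spaces.\<close>

lemma trig_closure_indicator_borel:
  assumes "A \<in> sets (borel :: 'a::euclidean_space measure)"
  shows "trig_closure (indicator A :: 'a \<Rightarrow> real)"
proof -
  have "A \<in> sigma_sets UNIV ((\<lambda>(a, i). {x::'a. a < x \<bullet> i}) ` (UNIV \<times> Basis))"
    using assms by (subst (asm) borel_eq_halfspace_greater) simp
  then show ?thesis
  proof induction
    case (Basic A)
    then show ?case using trig_closure_indicator_halfspace by auto
  next
    case Empty
    then show ?case using trig_closure_const[of 0] by (simp add: indicator_def)
  next
    case (Compl A)
    have "(indicator (UNIV - A) :: 'a \<Rightarrow> real) = (\<lambda>x. 1 - indicator A x)"
      by (auto simp: indicator_def)
    then show ?case using trig_closure_diff[OF trig_closure_const Compl.IH] by simp
  next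
    case (Union A)
    have fin: "trig_closure (indicator (\<Union>i<n. A i) :: 'a \<Rightarrow> real)" for n :: nat
    proof (induction n)
      case 0
      then show ?case using trig_closure_const[of 0] by (simp add: indicator_def)
    next
      case (Suc n)
      have "(indicator (\<Union>i<Suc n. A i) :: 'a \<Rightarrow> real)
          = (\<lambda>x. indicator (\<Union>i<n. A i) x + indicator (A n) x
              - indicator (\<Union>i<n. A i) x * indicator (A n) x)"
        by (auto simp: indicator_def lessThan_Suc fun_eq_iff)
      then show ?case
        using Suc Union.IH by (auto intro!: trig_closure_diff trig_closure.add trig_closure_mult)
    qed
    show ?case
    proof (rule trig_closure.lim[OF fin])
      show "\<bar>indicator (\<Union>i<n. A i) x :: real\<bar> \<le> 1" for n x by (simp add: indicator_def)
      show "(\<lambda>n. indicator (\<Union>i<n. A i) x) \<longlonglongrightarrow> (indicator (\<Union>i. A i) x :: real)" for x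
        by (rule LIMSEQ_indicator_UN)
    qed
  qed
qed

subsection \<open>Density of polynomials in a weighted space\<close>

text \<open>Replaces the Minkowski inequality: with squared distances the loss of a factor 2 is
  harmless, as \<open>\<epsilon>\<close> can be shrunk, and no square roots appear.\<close>

lemma norm_add_square_le:
  fixes x y :: "'a::real_normed_vector"
  shows "(norm (x + y))\<^sup>2 \<le> 2 * (norm x)\<^sup>2 + 2 * (norm y)\<^sup>2"
proof -
  have "(norm (x + y))\<^sup>2 \<le> (norm x + norm y)\<^sup>2"
    by (intro power_mono norm_triangle_ineq) simp
  also have "\<dots> \<le> 2 * (norm x)\<^sup>2 + 2 * (norm y)\<^sup>2"
    using zero_le_power2[of "norm x - norm y"] by (simp add: power2_eq_square algebra_simps)
  finally show ?thesis .
qed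

section \<open>Square integrable functions as a vector space\<close>

lemma L2_space_bound:
  assumes "f \<in> borel_measurable M" "integrable M (\<lambda>x. (w x)\<^sup>2)" "\<And>x. cmod (f x) \<le> w x"
  shows "f \<in> L2_space M"
proof -
  have "integrable M (\<lambda>x. (cmod (f x))\<^sup>2)"
  proof (rule Bochner_Integration.integrable_bound[OF assms(2)])
    show "AE x in M. norm ((cmod (f x))\<^sup>2) \<le> norm ((w x)\<^sup>2)"
      using assms(3) by (intro always_eventually) (simp add: power_mono)
  qed (use assms(1) in measurable)
  with assms(1) show ?thesis by (simp add: L2_space_def)
qed

lemma L2_space_add:
  assumes "f \<in> L2_space M" "g \<in> L2_space M"
  shows "(\<lambda>x. f x + g x) \<in> L2_space M"
proof -
  have [measurable]: "f \<in> borel_measurable M" "g \<in> borel_measurable M"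
    and int: "integrable M (\<lambda>x. (cmod (f x))\<^sup>2)" "integrable M (\<lambda>x. (cmod (g x))\<^sup>2)"
    using assms by (auto simp: L2_space_def)
  have "integrable M (\<lambda>x. (cmod (f x + g x))\<^sup>2)"
  proof (rule Bochner_Integration.integrable_bound)
    show "integrable M (\<lambda>x. 2 * (cmod (f x))\<^sup>2 + 2 * (cmod (g x))\<^sup>2)" using int by simp
    show "AE x in M. norm ((cmod (f x + g x))\<^sup>2) \<le> norm (2 * (cmod (f x))\<^sup>2 + 2 * (cmod (g x))\<^sup>2)"
      using norm_add_square_le[of "f _" "g _"] by (intro always_eventually) simp
  qed measurable
  then show ?thesis by (simp add: L2_space_def)
qed

lemma L2_space_scale:
  assumes "f \<in> L2_space M"
  shows "(\<lambda>x. c * f x) \<in> L2_space M"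
  using assms by (auto simp: L2_space_def norm_mult power_mult_distrib)

lemma L2_space_diff:
  assumes "f \<in> L2_space M" "g \<in> L2_space M"
  shows "(\<lambda>x. f x - g x) \<in> L2_space M"
  using L2_space_add[OF assms(1) L2_space_scale[OF assms(2), of "-1"]] by simp

lemma L2_integral_add_le:
  assumes "f \<in> L2_space M" "g \<in> L2_space M"
  shows "(LINT x|M. (cmod (f x + g x))\<^sup>2)
    \<le> 2 * (LINT x|M. (cmod (f x))\<^sup>2) + 2 * (LINT x|M. (cmod (g x))\<^sup>2)"
proof -
  have int: "integrable M (\<lambda>x. (cmod (f x))\<^sup>2)" "integrable M (\<lambda>x. (cmod (g x))\<^sup>2)"
    using assms by (auto simp: L2_space_def)
  have "(LINT x|M. (cmod (f x + g x))\<^sup>2) \<le> (LINT x|M. 2 * (cmod (f x))\<^sup>2 + 2 * (cmod (g x))\<^sup>2)"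
    using int L2_space_add[OF assms] norm_add_square_le[of "f _" "g _"]
    by (intro integral_mono) (auto simp: L2_space_def)
  then show ?thesis using int by simp
qed

section \<open>The closure of a subspace, measured by squared distances\<close>

definition L2_closure :: "'a measure \<Rightarrow> ('a \<Rightarrow> complex) set \<Rightarrow> ('a \<Rightarrow> complex) set" where
  "L2_closure M P = {f \<in> L2_space M. \<forall>\<epsilon>>0. \<exists>p\<in>P. (LINT x|M. (cmod (f x - p x))\<^sup>2) < \<epsilon>}"

locale L2_subspace =
  fixes M :: "'a measure" and P :: "('a \<Rightarrow> complex) set"
  assumes subset_L2: "P \<subseteq> L2_space M"
    and add_closed: "p \<in> P \<Longrightarrow> q \<in> P \<Longrightarrow> (\<lambda>x. p x + q x) \<in> P"
    and scale_closed: "p \<in> P \<Longrightarrow> (\<lambda>x. c * p x) \<in> P"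
begin

lemma subset_closure: "P \<subseteq> L2_closure M P"
  using subset_L2 by (force simp: L2_closure_def)

lemma closure_add:
  assumes f: "f \<in> L2_closure M P" and g: "g \<in> L2_closure M P"
  shows "(\<lambda>x. f x + g x) \<in> L2_closure M P"
  unfolding L2_closure_def
proof (intro CollectI conjI allI impI)
  have fL: "f \<in> L2_space M" and gL: "g \<in> L2_space M" using f g by (auto simp: L2_closure_def)
  then show "(\<lambda>x. f x + g x) \<in> L2_space M" by (rule L2_space_add)
  fix \<epsilon> :: real assume "\<epsilon> > 0"
  then have "\<epsilon> / 4 > 0" by simp
  then obtain p q where p: "p \<in> P" "(LINT x|M. (cmod (f x - p x))\<^sup>2) < \<epsilon> / 4"
    and q: "q \<in> P" "(LINT x|M. (cmod (g x - q x))\<^sup>2) < \<epsilon> / 4"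
    using f g unfolding L2_closure_def by blast
  have "(LINT x|M. (cmod ((f x - p x) + (g x - q x)))\<^sup>2) \<le>
      2 * (LINT x|M. (cmod (f x - p x))\<^sup>2) + 2 * (LINT x|M. (cmod (g x - q x))\<^sup>2)"
    using p q fL gL subset_L2 by (intro L2_integral_add_le L2_space_diff) auto
  also have "\<dots> < \<epsilon>" using p(2) q(2) by simp
  finally have "(LINT x|M. (cmod (f x + g x - (p x + q x)))\<^sup>2) < \<epsilon>"
    by (simp add: add_diff_add)
  then show "\<exists>r\<in>P. (LINT x|M. (cmod (f x + g x - r x))\<^sup>2) < \<epsilon>"
    by (intro bexI[of _ "\<lambda>x. p x + q x"] add_closed p q)
qed

lemma closure_scale:
  assumes f: "f \<in> L2_closure M P"
  shows "(\<lambda>x. c * f x) \<in> L2_closure M P"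
  unfolding L2_closure_def
proof (intro CollectI conjI allI impI)
  have fL: "f \<in> L2_space M" using f by (auto simp: L2_closure_def)
  then show "(\<lambda>x. c * f x) \<in> L2_space M" by (rule L2_space_scale)
  fix \<epsilon> :: real assume "\<epsilon> > 0"
  \<comment> \<open>Adding 1 keeps the denominator positive when \<open>c\<close> is 0.\<close>
  then have "\<epsilon> / ((cmod c)\<^sup>2 + 1) > 0" by (simp add: add_nonneg_pos)
  then obtain p where p: "p \<in> P" "(LINT x|M. (cmod (f x - p x))\<^sup>2) < \<epsilon> / ((cmod c)\<^sup>2 + 1)"
    using f unfolding L2_closure_def by blast
  have "(LINT x|M. (cmod (c * f x - c * p x))\<^sup>2) = (cmod c)\<^sup>2 * (LINT x|M. (cmod (f x - p x))\<^sup>2)"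
    by (simp add: norm_mult power_mult_distrib flip: right_diff_distrib)
  also have "\<dots> \<le> ((cmod c)\<^sup>2 + 1) * (LINT x|M. (cmod (f x - p x))\<^sup>2)"
    by (intro mult_right_mono) auto
  also have "\<dots> < \<epsilon>"
    using p(2) by (simp add: pos_less_divide_eq add_nonneg_pos mult.commute)
  finally show "\<exists>r\<in>P. (LINT x|M. (cmod (c * f x - r x))\<^sup>2) < \<epsilon>"
    by (intro bexI[of _ "\<lambda>x. c * p x"] scale_closed p)
qed

text \<open>The limit inherits the bound \<open>w\<close>, so the squared differences are at most
  \<open>4 * (w x)\<^sup>2\<close> and dominated convergence gives convergence in mean square. An
  element of \<open>P\<close> close to a late \<open>g n\<close> is then close to
  \<open>f\<close>.\<close>

lemma closure_dominated_limit:
  assumes g: "\<And>n::nat. g n \<in> L2_closure M P"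
    and f: "f \<in> borel_measurable M"
    and w: "integrable M (\<lambda>x. (w x)\<^sup>2)"
    and bound: "\<And>n x. cmod (g n x) \<le> w x"
    and lim: "\<And>x. (\<lambda>n. g n x) \<longlonglongrightarrow> f x"
  shows "f \<in> L2_closure M P"
  unfolding L2_closure_def
proof (intro CollectI conjI allI impI)
  have gL: "g n \<in> L2_space M" for n using g by (auto simp: L2_closure_def)
  have fw: "cmod (f x) \<le> w x" for x
    by (rule LIMSEQ_le_const2[OF tendsto_norm[OF lim]]) (use bound in blast)
  then show fL: "f \<in> L2_space M" by (rule L2_space_bound[OF f w])
  have meas[measurable]: "g n \<in> borel_measurable M" "f \<in> borel_measurable M" for n
    using f gL by (auto simp: L2_space_def)
  have conv: "(\<lambda>n. LINT x|M. (cmod (f x - g n x))\<^sup>2) \<longlonglongrightarrow> (LINT x|M. 0)"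
  proof (rule integral_dominated_convergence)
    show "integrable M (\<lambda>x. 4 * (w x)\<^sup>2)" using w by simp
    show "AE x in M. (\<lambda>n. (cmod (f x - g n x))\<^sup>2) \<longlonglongrightarrow> 0"
    proof (intro always_eventually allI)
      fix x
      have "(\<lambda>n. (cmod (f x - g n x))\<^sup>2) \<longlonglongrightarrow> (cmod (f x - f x))\<^sup>2"
        by (intro tendsto_intros lim)
      then show "(\<lambda>n. (cmod (f x - g n x))\<^sup>2) \<longlonglongrightarrow> 0" by simp
    qed
    show "AE x in M. norm ((cmod (f x - g n x))\<^sup>2) \<le> 4 * (w x)\<^sup>2" for n
    proof (intro always_eventually allI)
      fix x
      have "cmod (f x - g n x) \<le> 2 * w x"
        using norm_triangle_ineq4[of "f x" "g n x"] fw[of x] bound[of n x] by linarith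
      then have "(cmod (f x - g n x))\<^sup>2 \<le> (2 * w x)\<^sup>2" by (intro power_mono) auto
      then show "norm ((cmod (f x - g n x))\<^sup>2) \<le> 4 * (w x)\<^sup>2" by (simp add: power_mult_distrib)
    qed
  qed measurable
  fix \<epsilon> :: real assume e: "\<epsilon> > 0"
  then obtain n where n: "(LINT x|M. (cmod (f x - g n x))\<^sup>2) < \<epsilon> / 4"
    using order_tendstoD(2)[OF conv, of "\<epsilon> / 4"] by (auto simp: eventually_sequentially)
  obtain p where p: "p \<in> P" "(LINT x|M. (cmod (g n x - p x))\<^sup>2) < \<epsilon> / 4"
    using g[of n] e unfolding L2_closure_def by (auto dest: spec[of _ "\<epsilon> / 4"])
  have "(LINT x|M. (cmod ((f x - g n x) + (g n x - p x)))\<^sup>2) \<le>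
      2 * (LINT x|M. (cmod (f x - g n x))\<^sup>2) + 2 * (LINT x|M. (cmod (g n x - p x))\<^sup>2)"
    using p fL gL subset_L2 by (intro L2_integral_add_le L2_space_diff) auto
  also have "\<dots> < \<epsilon>" using p(2) n by simp
  finally show "\<exists>r\<in>P. (LINT x|M. (cmod (f x - r x))\<^sup>2) < \<epsilon>"
    using p(1) by auto
qed

end

text \<open>Constants and closure under multiplication by linear forms put all polynomials into
  \<open>P\<close>. The exponential moments hold for every \<open>k\<close>; they provide the
  majorant for the Taylor series of an exponential.\<close>

locale polynomial_subspace = L2_subspace M P
  for M :: "'a::euclidean_space measure" and P +
  assumes sets_M [measurable_cong]: "sets M = sets borel"
    and exp_norm_integrable: "integrable M (\<lambda>x. exp (k * norm x))"
    and one_mem: "(\<lambda>x. 1) \<in> P"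
    and inner_mult_closed: "p \<in> P \<Longrightarrow> (\<lambda>x. of_real (x \<bullet> \<xi>) * p x) \<in> P"
begin

lemma inner_power_mem: "(\<lambda>x. of_real (x \<bullet> \<xi>) ^ k) \<in> P"
proof (induction k)
  case (Suc k)
  from inner_mult_closed[OF this] show ?case by simp
qed (simp add: one_mem)

text \<open>The Taylor partial sums are polynomials in \<open>x \<bullet> \<xi>\<close>, all bounded
  by the exponential of \<open>norm \<xi> * norm x\<close>, whose square is an exponential
  moment.\<close>

lemma exp_inner_mem_closure: "(\<lambda>x. exp (\<i> * of_real (x \<bullet> \<xi>))) \<in> L2_closure M P"
proof (rule closure_dominated_limit)
  let ?g = "\<lambda>n x. \<Sum>k<n. (\<i> * of_real (x \<bullet> \<xi>)) ^ k /\<^sub>R fact k"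
  show "?g n \<in> L2_closure M P" for n
  proof -
    have "?g n \<in> P"
    proof (induction n)
      case 0
      from scale_closed[OF one_mem, of 0] show ?case by simp
    next
      case (Suc n)
      have "(\<lambda>x. (\<i> ^ n / fact n) * of_real (x \<bullet> \<xi>) ^ n) \<in> P"
        by (intro scale_closed inner_power_mem)
      from add_closed[OF Suc this] show ?case
        by (simp add: power_mult_distrib scaleR_conv_of_real divide_inverse mult_ac)
    qed
    then show ?thesis using subset_closure by blast
  qed
  show "(\<lambda>x. exp (\<i> * of_real (x \<bullet> \<xi>))) \<in> borel_measurable M" by measurable
  show "integrable M (\<lambda>x. (exp (norm \<xi> * norm x))\<^sup>2)"
    using exp_norm_integrable[of "2 * norm \<xi>"] by (simp add: mult.assoc exp_double)
  show "(\<lambda>n. ?g n x) \<longlonglongrightarrow> exp (\<i> * of_real (x \<bullet> \<xi>))" for x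
    using exp_converges[of "\<i> * of_real (x \<bullet> \<xi>)"] by (simp add: sums_def)
  show "cmod (?g n x) \<le> exp (norm \<xi> * norm x)" for n x
  proof -
    have "cmod (?g n x) \<le> (\<Sum>k<n. \<bar>x \<bullet> \<xi>\<bar> ^ k /\<^sub>R fact k)"
      by (rule order_trans[OF norm_sum]) (simp add: norm_power norm_mult)
    also have "\<dots> \<le> exp \<bar>x \<bullet> \<xi>\<bar>"
      using exp_converges[of "\<bar>x \<bullet> \<xi>\<bar>"]
      by (intro sum_le_suminf[THEN order_trans]) (auto simp: sums_iff)
    also have "\<dots> \<le> exp (norm \<xi> * norm x)"
      using Cauchy_Schwarz_ineq2[of x \<xi>] by (simp add: mult.commute)
    finally show ?thesis .
  qed
qed

text \<open>The exponential moment with \<open>k = 0\<close> says that \<open>M\<close> is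
  finite.\<close>

lemma const_square_integrable: "integrable M (\<lambda>x. (c::real)\<^sup>2)"
  using integrable_mult_right[OF exp_norm_integrable[of 0], of "c\<^sup>2"] by simp

text \<open>Induction over the class: Euler's formula handles cosines, and the constant
  \<open>C\<close> is a square integrable majorant for bounded limits.\<close>

lemma trig_closure_mem_closure:
  assumes "trig_closure f"
  shows "(\<lambda>x. of_real (f x)) \<in> L2_closure M P"
  using assms
proof induction
  case (cos \<xi> c)
  have "(\<lambda>x. exp (\<i> * of_real c) / 2 * exp (\<i> * of_real (x \<bullet> \<xi>))
      + exp (- \<i> * of_real c) / 2 * exp (\<i> * of_real (x \<bullet> - \<xi>))) \<in> L2_closure M P"
    by (intro closure_add closure_scale exp_inner_mem_closure)
  moreover have "exp (\<i> * of_real c) / 2 * exp (\<i> * of_real t)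
      + exp (- \<i> * of_real c) / 2 * exp (\<i> * of_real (- t)) = of_real (cos (t + c))" for t
  proof -
    have "complex_of_real (cos (t + c)) = cos (of_real t + of_real c)"
      by (metis cos_of_real of_real_add)
    then show ?thesis
      by (simp add: cos_exp_eq algebra_simps flip: exp_add add_divide_distrib)
  qed
  ultimately show ?case by simp
next
  case (add f g)
  from closure_add[OF add.IH] show ?case by simp
next
  case (scale f c)
  from closure_scale[OF scale.IH] show ?case by simp
next
  case (lim f C g)
  show ?case
  proof (rule closure_dominated_limit[OF lim.IH])
    \<comment> \<open>Rule \<open>lim\<close> does not assume \<open>g\<close> measurable; this
      comes from the \<open>f n\<close>, which are measurable by the induction hypothesis.\<close>
    have "(\<lambda>x. complex_of_real (f n x)) \<in> borel_measurable M" for n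
      using lim.IH[of n] by (simp add: L2_closure_def L2_space_def)
    then have "f n \<in> borel_measurable M" for n
      by (simp add: borel_measurable_complex_iff)
    then have "g \<in> borel_measurable M"
      using borel_measurable_LIMSEQ_real[of M f g] lim(3) by simp
    then show "(\<lambda>x. complex_of_real (g x)) \<in> borel_measurable M" by measurable
    show "integrable M (\<lambda>x. C\<^sup>2)" by (rule const_square_integrable)
    show "cmod (of_real (f n x)) \<le> C" for n x using lim(2) by simp
    show "(\<lambda>n. complex_of_real (f n x)) \<longlonglongrightarrow> of_real (g x)" for x
      by (intro tendsto_of_real lim)
  qed
qed

lemma closure_sum:
  assumes "finite I" "\<And>i. i \<in> I \<Longrightarrow> f i \<in> L2_closure M P"
  shows "(\<lambda>x. \<Sum>i\<in>I. f i x) \<in> L2_closure M P"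
  using assms
proof (induction I)
  case empty
  have "(\<lambda>x. 0 * 1) \<in> L2_closure M P" using scale_closed[OF one_mem] subset_closure by blast
  then show ?case by simp
next
  case (insert i I)
  have "(\<lambda>x. f i x + (\<Sum>i\<in>I. f i x)) \<in> L2_closure M P"
    using insert by (intro closure_add) auto
  then show ?case using insert.hyps by simp
qed

text \<open>Every square integrable \<open>f\<close> is a pointwise limit of simple functions
  bounded by \<open>2 * cmod (f x)\<close>, and these are finite combinations of indicators of Borel
  sets, already known to lie in the closure.\<close>

theorem polynomials_dense: "L2_closure M P = L2_space M"
proof (intro equalityI subsetI)
  fix f assume f: "f \<in> L2_space M"
  have [simp]: "space M = UNIV" using sets_eq_imp_space_eq[OF sets_M] by simp
  have meas: "f \<in> borel_measurable M" and int: "integrable M (\<lambda>x. (cmod (f x))\<^sup>2)"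
    using f by (auto simp: L2_space_def)
  obtain s where s: "\<And>i. simple_function M (s i)" "\<And>x. (\<lambda>i. s i x) \<longlonglongrightarrow> f x"
    and bound: "\<And>i x. dist (s i x) 0 \<le> 2 * dist (f x) 0"
    using borel_measurable_implies_sequence_metric[OF meas, of 0] by auto
  show "f \<in> L2_closure M P"
  proof (rule closure_dominated_limit[OF _ meas _ _ s(2)])
    show "integrable M (\<lambda>x. (2 * cmod (f x))\<^sup>2)" using int by (simp add: power_mult_distrib)
    show "cmod (s i x) \<le> 2 * cmod (f x)" for i x using bound[of i x] by simp
    show "s i \<in> L2_closure M P" for i
    proof -
      have "(\<lambda>x. \<Sum>y\<in>range (s i). y * of_real (indicator (s i -` {y}) x)) \<in> L2_closure M P"
      proof (rule closure_sum)
        show "finite (range (s i))" using s(1)[of i] by (simp add: simple_function_def)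
        show "(\<lambda>x. y * of_real (indicator (s i -` {y}) x)) \<in> L2_closure M P"
          if "y \<in> range (s i)" for y
        proof -
          have "s i -` {y} \<in> sets M" using simple_functionD(2)[OF s(1), of i "{y}"] by simp
          then show ?thesis
            by (intro closure_scale trig_closure_mem_closure trig_closure_indicator_borel)
               (simp add: sets_M)
        qed
      qed
      moreover have "(\<Sum>y\<in>range (s i). y * of_real (indicator (s i -` {y}) x)) = s i x" for x
      proof -
        have "(\<Sum>y\<in>range (s i). y * of_real (indicator (s i -` {y}) x))
            = (\<Sum>y\<in>range (s i). if y = s i x then s i x else 0)"
          by (intro sum.cong) (auto simp: indicator_def)
        also have "\<dots> = s i x" using s(1)[of i] by (simp add: simple_function_def)
        finally show ?thesis .
      qed
      ultimately show ?thesis by simp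
    qed
  qed
qed (simp add: L2_closure_def)

end

subsection \<open>Univariate complex Hermite polynomials\<close>

text \<open>A recursion in the first index in place of iterated derivatives;
  \<open>complex_hermite_eq_hermite_poly\<close> proves agreement with the Rodrigues formula. For
  \<open>n = 0\<close> the truncated index \<open>n - 1\<close> is harmless, because its coefficient
  is 0.\<close>

fun hermite_poly :: "nat \<Rightarrow> nat \<Rightarrow> complex \<Rightarrow> complex" where
  "hermite_poly 0 n z = cnj z ^ n"
| "hermite_poly (Suc m) n z = z * hermite_poly m n z - of_nat n * hermite_poly m (n - 1) z"

lemma mult_hermite_poly: "z * hermite_poly m n z = hermite_poly (Suc m) n z + of_nat n * hermite_poly m (n - 1) z"
  by simp

text \<open>The mirror image of \<open>mult_hermite_poly\<close>. The recursion treats the two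
  indices asymmetrically, so this one takes an induction.\<close>

lemma cnj_mult_hermite_poly: "cnj z * hermite_poly m n z = hermite_poly m (Suc n) z + of_nat m * hermite_poly (m - 1) n z"
proof (induction m arbitrary: n)
  case (Suc m)
  have "cnj z * hermite_poly (Suc m) n z = z * (cnj z * hermite_poly m n z) - of_nat n * (cnj z * hermite_poly m (n - 1) z)"
    by (simp add: algebra_simps)
  also have "\<dots> = z * (hermite_poly m (Suc n) z + of_nat m * hermite_poly (m - 1) n z)
      - of_nat n * (hermite_poly m n z + of_nat m * hermite_poly (m - 1) (n - 1) z)"
    \<comment> \<open>The hypothesis at \<open>n - 1\<close> produces \<open>Suc (n - 1)\<close>,
      which is \<open>n\<close> unless \<open>n = 0\<close>, where the whole term has coefficient
      0.\<close>
    unfolding Suc.IH by (cases n) simp_all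
  also have "\<dots> = hermite_poly (Suc m) (Suc n) z + of_nat (Suc m) * hermite_poly m n z"
    by (cases m) (simp_all add: algebra_simps)
  finally show ?case by simp
qed simp

text \<open>A derivative in a general direction \<open>a\<close> carries both Wirtinger derivatives
  at once, as the coefficients of \<open>a\<close> and \<open>cnj a\<close>.\<close>

lemma hermite_poly_has_vector_derivative:
  "((\<lambda>t. hermite_poly m n (z + of_real t * a)) has_vector_derivative
     (a * of_nat m * hermite_poly (m - 1) n (z + of_real t * a)
      + cnj a * of_nat n * hermite_poly m (n - 1) (z + of_real t * a))) (at t)"
proof (induction m arbitrary: n)
  case 0
  show ?case
  proof -
    have *: "((\<lambda>t. cnj z + of_real t * cnj a) has_vector_derivative cnj a) (at t)"
      by (auto intro!: derivative_eq_intros)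
    have "((\<lambda>w. w ^ n) has_field_derivative of_nat n * (cnj z + of_real t * cnj a) ^ (n - 1))
        (at (cnj z + of_real t * cnj a))"
      by (auto intro!: derivative_eq_intros)
    from field_vector_diff_chain_at[OF * this] show ?thesis
      by (simp add: o_def mult_ac)
  qed
next
  case (Suc m)
  have lin: "((\<lambda>t. z + of_real t * a) has_vector_derivative a) (at t)"
    by (auto intro!: derivative_eq_intros)
  have "((\<lambda>t. hermite_poly (Suc m) n (z + of_real t * a)) has_vector_derivative
     (z + of_real t * a) * (a * of_nat m * hermite_poly (m - 1) n (z + of_real t * a)
      + cnj a * of_nat n * hermite_poly m (n - 1) (z + of_real t * a))
     + a * hermite_poly m n (z + of_real t * a)
     - of_nat n * (a * of_nat m * hermite_poly (m - 1) (n - 1) (z + of_real t * a)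
      + cnj a * of_nat (n - 1) * hermite_poly m (n - 1 - 1) (z + of_real t * a))) (at t)"
    unfolding hermite_poly.simps
    by (intro has_vector_derivative_diff has_vector_derivative_mult lin Suc.IH
        has_vector_derivative_mult_right)
  then show ?case
    by (rule has_vector_derivative_eq_rhs) (cases m; simp add: algebra_simps)
qed

lemma gauss_has_vector_derivative:
  "((\<lambda>t. of_real (exp (- (cmod (z + of_real t * a))\<^sup>2))) has_vector_derivative
     - (a * cnj (z + of_real t * a) + cnj a * (z + of_real t * a)) *
       of_real (exp (- (cmod (z + of_real t * a))\<^sup>2))) (at t)"
proof -
  have eq: "complex_of_real (exp (- (cmod x)\<^sup>2)) = exp (- (x * cnj x))" for x
    by (simp flip: complex_norm_square exp_of_real)
  have *: "((\<lambda>t. - ((z + of_real t * a) * cnj (z + of_real t * a))) has_vector_derivative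
     - (a * cnj (z + of_real t * a) + cnj a * (z + of_real t * a))) (at t)"
    by (auto intro!: derivative_eq_intros simp: algebra_simps)
  show ?thesis
    unfolding eq
    using field_vector_diff_chain_at[OF * DERIV_exp] by (simp add: o_def)
qed

text \<open>These turn out to be the mixed Wirtinger derivatives of the Gaussian, \<open>m\<close>
  times in the conjugate variable and \<open>n\<close> times in the variable itself.\<close>

definition hermite_gauss :: "nat \<Rightarrow> nat \<Rightarrow> complex \<Rightarrow> complex" where
  "hermite_gauss m n z = (-1) ^ (m + n) * hermite_poly m n z * of_real (exp (- (cmod z)\<^sup>2))"

text \<open>In the product rule, differentiating the polynomial lowers an index and differentiating
  the Gaussian multiplies by \<open>z\<close> or \<open>cnj z\<close>; the two recurrences merge
  these terms into one raised index each.\<close>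

lemma hermite_gauss_has_vector_derivative:
  "((\<lambda>t. hermite_gauss m n (z + of_real t * a)) has_vector_derivative
     (a * hermite_gauss m (Suc n) (z + of_real t * a)
      + cnj a * hermite_gauss (Suc m) n (z + of_real t * a))) (at t)"
proof -
  \<comment> \<open>Here \<open>h\<close> is the polynomial with indices (m, n), \<open>h1\<close>
    and \<open>h2\<close> have \<open>m\<close> and \<open>n\<close> lowered, \<open>h3\<close> and
    \<open>h4\<close> have \<open>n\<close> and \<open>m\<close> raised; \<open>s\<close> is the
    sign and \<open>e\<close> the Gaussian.\<close>
  have alg: "(s * h) * (- (a * cnj y + cnj a * y) * e) + (s * (a * of_nat m * h1 + cnj a * of_nat n * h2)) * e
      = a * (- s * h3 * e) + cnj a * (- s * h4 * e)"
    if "cnj y * h = h3 + of_nat m * h1" "y * h = h4 + of_nat n * h2" for y h h1 h2 h3 h4 e s :: complex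
  proof -
    have h: "h3 = cnj y * h - of_nat m * h1" "h4 = y * h - of_nat n * h2" using that by simp_all
    show ?thesis unfolding h by (simp add: algebra_simps)
  qed
  show ?thesis
    unfolding hermite_gauss_def add_Suc_right add_Suc power_Suc mult_minus1
    by (rule has_vector_derivative_eq_rhs
        [OF has_vector_derivative_mult[OF has_vector_derivative_mult_right
            [OF hermite_poly_has_vector_derivative] gauss_has_vector_derivative]])
       (rule alg[OF cnj_mult_hermite_poly mult_hermite_poly])
qed

text \<open>The directions 1 and i give the two partial derivatives, and their Wirtinger
  combinations isolate one raised index each.\<close>

lemma wirtinger_hermite_gauss: "wirtinger (hermite_gauss m n) = hermite_gauss m (Suc n)"
  and wirtinger_bar_hermite_gauss: "wirtinger_bar (hermite_gauss m n) = hermite_gauss (Suc m) n"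
proof -
  have 1: "vector_derivative (\<lambda>x::real. hermite_gauss m n (z + of_real x)) (at 0)
      = hermite_gauss m (Suc n) z + hermite_gauss (Suc m) n z" for z
    using hermite_gauss_has_vector_derivative[of m n z 1 0] by (simp add: vector_derivative_at)
  have 2: "vector_derivative (\<lambda>y::real. hermite_gauss m n (z + \<i> * of_real y)) (at 0)
      = \<i> * hermite_gauss m (Suc n) z - \<i> * hermite_gauss (Suc m) n z" for z
    using hermite_gauss_has_vector_derivative[of m n z \<i> 0]
    by (simp add: vector_derivative_at mult.commute)
  show "wirtinger (hermite_gauss m n) = hermite_gauss m (Suc n)"
    "wirtinger_bar (hermite_gauss m n) = hermite_gauss (Suc m) n"
    unfolding wirtinger_def wirtinger_bar_def 1 2 by (auto simp: fun_eq_iff algebra_simps)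
qed

lemma complex_hermite_eq_hermite_poly: "complex_hermite m n = hermite_poly m n"
proof -
  have "(\<lambda>z. complex_of_real (exp (- (cmod z)\<^sup>2))) = hermite_gauss 0 0"
    by (simp add: hermite_gauss_def fun_eq_iff)
  moreover have "(wirtinger ^^ n) (hermite_gauss 0 0) = hermite_gauss 0 n"
    by (induction n) (simp_all add: wirtinger_hermite_gauss)
  moreover have "(wirtinger_bar ^^ m) (hermite_gauss 0 n) = hermite_gauss m n"
    by (induction m) (simp_all add: wirtinger_bar_hermite_gauss)
  ultimately have eq: "complex_hermite m n z = (-1) ^ (m + n) * of_real (exp ((cmod z)\<^sup>2)) *
      hermite_gauss m n z" for z
    by (simp add: complex_hermite_def)
  have "complex_of_real (exp ((cmod z)\<^sup>2)) * of_real (exp (- (cmod z)\<^sup>2)) = 1"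
    "(-1 :: complex) ^ (m + n) * (-1) ^ (m + n) = 1" for z
    by (simp_all flip: of_real_mult exp_add power_mult_distrib)
  moreover have "s * e * (s * h * e') = h" if "e * e' = 1" "s * s = 1" for s e e' h :: complex
  proof -
    have "s * e * (s * h * e') = (e * e') * (s * s) * h" by (simp only: mult_ac)
    then show ?thesis by (simp add: that)
  qed
  ultimately show ?thesis
    unfolding eq hermite_gauss_def fun_eq_iff by blast
qed

subsection \<open>Gaussian integrals\<close>

text \<open>The Gaussian factors over the coordinates into one-dimensional Gaussian
  integrals.\<close>

lemma nn_integral_gaussian_finite:
  "(\<integral>\<^sup>+x. ennreal (exp (- (norm (x::'a::euclidean_space))\<^sup>2)) \<partial>lborel) < \<infinity>"
proof -
  have "ennreal (exp (- (norm x)\<^sup>2)) = (\<Prod>b\<in>Basis. ennreal (exp (- (x \<bullet> b)\<^sup>2)))" for x :: 'a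
  proof -
    have "(norm x)\<^sup>2 = (\<Sum>b\<in>Basis. (x \<bullet> b)\<^sup>2)"
      unfolding power2_norm_eq_inner by (subst euclidean_inner) (simp add: power2_eq_square)
    then show ?thesis
      by (simp add: prod_ennreal exp_sum flip: sum_negf)
  qed
  then have "(\<integral>\<^sup>+x. ennreal (exp (- (norm (x::'a))\<^sup>2)) \<partial>lborel)
      = (\<Prod>b\<in>(Basis :: 'a set). (\<integral>\<^sup>+t. ennreal (exp (- t\<^sup>2)) \<partial>lborel))"
    using nn_integral_lborel_prod[where 'a = 'a and f = "\<lambda>_ t. ennreal (exp (- t\<^sup>2))"] by simp
  moreover have "(\<integral>\<^sup>+t. ennreal (exp (- t\<^sup>2)) \<partial>lborel) = ennreal (sqrt pi)"
  proof -
    \<comment> \<open>\<open>gaussian_moment_0\<close> is the integral over the half line; evenness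
      doubles it.\<close>
    have "has_bochner_integral lborel (\<lambda>x::real. exp (- x\<^sup>2)) (sqrt pi)"
      using has_bochner_integral_even_function[OF gaussian_moment_0] by simp
    then show ?thesis
      by (simp add: has_bochner_integral_iff nn_integral_eq_integral)
  qed
  ultimately show ?thesis by (simp add: power_less_top_ennreal)
qed

lemma integrable_exp_norm_gaussian:
  "integrable lborel (\<lambda>x::'a::euclidean_space. exp (k * norm x) * exp (- 2 * (norm x)\<^sup>2))"
proof (rule Bochner_Integration.integrable_bound)
  show "integrable lborel (\<lambda>x::'a. exp (k\<^sup>2 / 4) * exp (- (norm x)\<^sup>2))"
    using nn_integral_gaussian_finite[where 'a = 'a]
    by (intro integrable_mult_right integrableI_bounded) simp_all
  \<comment> \<open>Completing the square: the difference of the two sides is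
    \<open>(r - k / 2)\<^sup>2\<close>. One half of the Gaussian exponent is spent on absorbing the
    exponential.\<close>
  have "k * r - 2 * r\<^sup>2 \<le> k\<^sup>2 / 4 - r\<^sup>2" for r :: real
    using zero_le_power2[of "r - k / 2"] by (simp add: power2_eq_square algebra_simps)
  then show "AE x::'a in lborel. norm (exp (k * norm x) * exp (- 2 * (norm x)\<^sup>2))
      \<le> norm (exp (k\<^sup>2 / 4) * exp (- (norm x)\<^sup>2))"
    by (simp flip: exp_add)
qed measurable

section \<open>Translation invariance and integrals of derivatives\<close>

lemma lborel_translate:
  fixes f :: "'a::euclidean_space \<Rightarrow> 'b::{banach, second_countable_topology}"
  assumes [measurable]: "f \<in> borel_measurable borel"
  shows lborel_integral_translate: "(LINT x|lborel. f (x + c)) = integral\<^sup>L lborel f"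
    and lborel_integrable_translate: "integrable lborel f \<Longrightarrow> integrable lborel (\<lambda>x. f (x + c))"
proof -
  have eq: "distr lborel borel (\<lambda>x. x + c) = lborel"
  proof -
    have "(+) c = (\<lambda>x. x + c)" by (auto simp: add.commute)
    then show ?thesis using lborel_distr_plus[of c] by simp
  qed
  show "(LINT x|lborel. f (x + c)) = integral\<^sup>L lborel f"
    by (subst eq[symmetric], subst integral_distr) auto
  show "integrable lborel (\<lambda>x. f (x + c))" if "integrable lborel f"
    using that by (subst (asm) eq[symmetric], subst (asm) integrable_distr_eq) auto
qed

text \<open>Integrate \<open>F (x + e) - F x = \<integral>\<^sub>0\<^sup>1 F' (x + t e) dt\<close> over \<open>x\<close>: by translation invariance the left side
  gives \<open>0\<close> and, after Fubini, the right side gives the integral of \<open>F'\<close>.\<close>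

lemma integral_directional_derivative_eq_0:
  fixes F F' :: "'a::euclidean_space \<Rightarrow> complex"
  assumes deriv: "\<And>x t. ((\<lambda>t. F (x + t *\<^sub>R e)) has_vector_derivative F' (x + t *\<^sub>R e)) (at t)"
    and cont: "continuous_on UNIV F'"
    and intF: "integrable lborel F" and intF': "integrable lborel F'"
  shows "integral\<^sup>L lborel F' = 0"
proof -
  have [measurable]: "F' \<in> borel_measurable borel"
    using cont by (rule borel_measurable_continuous_onI)
  have [measurable]: "F \<in> borel_measurable borel"
    using intF by auto
  define f where "f = (\<lambda>t x. indicator {0..1::real} t *\<^sub>R F' (x + t *\<^sub>R e))"
  have f_meas: "case_prod f \<in> borel_measurable (lborel \<Otimes>\<^sub>M lborel)"
    unfolding f_def by measurable
  \<comment> \<open>By translation invariance the inner integral of the norm does not depend on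
    \<open>t\<close> within the unit interval, so Fubini's hypotheses hold.\<close>
  have "integrable (lborel \<Otimes>\<^sub>M lborel) (case_prod f)"
  proof (rule lborel_pair.Fubini_integrable[OF f_meas])
    have "(\<lambda>t. LINT x|lborel. norm (case_prod f (t, x)))
        = (\<lambda>t. indicator {0..1} t * (LINT x|lborel. norm (F' x)))"
      using lborel_integral_translate[of "\<lambda>x. norm (F' x)"]
      by (simp add: f_def norm_scaleR indicator_def fun_eq_iff)
    then show "integrable lborel (\<lambda>t. LINT x|lborel. norm (case_prod f (t, x)))"
      by simp
    show "AE t in lborel. integrable lborel (\<lambda>x. case_prod f (t, x))"
      using lborel_integrable_translate[OF _ intF'] by (simp add: f_def)
  qed
  then have "(LINT x|lborel. LINT t|lborel. f t x) = (LINT t|lborel. LINT x|lborel. f t x)"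
    by (rule lborel_pair.Fubini_integral)
  also have "\<dots> = (LINT t|lborel. indicator {0..1::real} t *\<^sub>R integral\<^sup>L lborel F')"
    by (simp add: f_def lborel_integral_translate[of F'])
  also have "\<dots> = integral\<^sup>L lborel F'" by simp
  finally have "integral\<^sup>L lborel F' = (LINT x|lborel. LINT t|lborel. f t x)" ..
  moreover have "(LINT t|lborel. f t x) = F (x + e) - F x" for x
  proof -
    have "(LINT t|lborel. f t x) = F (x + 1 *\<^sub>R e) - F (x + 0 *\<^sub>R e)"
      unfolding f_def
      by (rule integral_FTC_atLeastAtMost)
         (auto intro: has_vector_derivative_at_within deriv
           intro!: continuous_on_compose2[OF cont] continuous_intros)
    then show ?thesis by simp
  qed
  moreover have "(LINT x|lborel. F (x + e) - F x) = 0"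
    using lborel_integral_translate[of F e] lborel_integrable_translate[of F e] intF by simp
  ultimately show ?thesis by simp
qed

text \<open>A growth class that needs no bookkeeping of degrees: it contains linear forms, is an
  algebra closed under conjugation, and is integrable against the Gaussian weight.\<close>

definition exp_bounded :: "('a::euclidean_space \<Rightarrow> complex) \<Rightarrow> bool" where
  "exp_bounded f \<longleftrightarrow> continuous_on UNIV f \<and> (\<exists>C k. \<forall>x. cmod (f x) \<le> C * exp (k * norm x))"

lemma exp_bounded_const: "exp_bounded (\<lambda>x::'a::euclidean_space. c)"
proof -
  have "\<forall>x::'a. cmod c \<le> cmod c * exp (0 * norm x)" by simp
  then have "\<exists>C k. \<forall>x::'a. cmod c \<le> C * exp (k * norm x)" by blast
  then show ?thesis by (simp add: exp_bounded_def)
qed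

lemma exp_bounded_linear:
  assumes "bounded_linear f"
  shows "exp_bounded f"
proof -
  obtain K where K: "K > 0" "\<And>x. cmod (f x) \<le> norm x * K"
    using bounded_linear.pos_bounded[OF assms] by blast
  have "cmod (f x) \<le> 1 * exp (K * norm x)" for x
    using K(2)[of x] exp_ge_add_one_self[of "K * norm x"] unfolding mult.commute[of K] by linarith
  then show ?thesis
    unfolding exp_bounded_def using linear_continuous_on[OF assms] by blast
qed

lemma exp_bounded_cnj: "exp_bounded f \<Longrightarrow> exp_bounded (\<lambda>x. cnj (f x))"
  by (auto simp: exp_bounded_def intro: continuous_intros)

lemma exp_bounded_mult:
  fixes f g :: "'a::euclidean_space \<Rightarrow> complex"
  assumes "exp_bounded f" "exp_bounded g"
  shows "exp_bounded (\<lambda>x. f x * g x)"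
proof -
  obtain C k D l where "\<And>x. cmod (f x) \<le> C * exp (k * norm x)" "\<And>x. cmod (g x) \<le> D * exp (l * norm x)"
    using assms unfolding exp_bounded_def by blast
  then have "cmod (f x) * cmod (g x) \<le> (C * exp (k * norm x)) * (D * exp (l * norm x))" for x
    by (intro mult_mono) (auto intro: order_trans[OF norm_ge_zero])
  moreover have "(C * exp (k * norm x)) * (D * exp (l * norm x)) = (C * D) * exp ((k + l) * norm x)"
    for x :: 'a by (simp add: exp_add distrib_right)
  ultimately have "cmod (f x * g x) \<le> (C * D) * exp ((k + l) * norm x)" for x
    by (simp only: norm_mult)
  moreover have "continuous_on UNIV (\<lambda>x. f x * g x)"
    using assms by (auto simp: exp_bounded_def intro: continuous_intros)
  ultimately show ?thesis unfolding exp_bounded_def by blast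
qed

lemma exp_bounded_add:
  fixes f g :: "'a::euclidean_space \<Rightarrow> complex"
  assumes "exp_bounded f" "exp_bounded g"
  shows "exp_bounded (\<lambda>x. f x + g x)"
proof -
  \<comment> \<open>To add two bounds they are first brought to the common rate
    \<open>max k l\<close>; the absolute value of \<open>C\<close> makes the bound monotone in the
    rate.\<close>
  have mono: "\<exists>C. \<forall>k'\<ge>k. \<forall>x. cmod (h x) \<le> C * exp (k' * norm x)"
    if h: "\<And>x. cmod (h x) \<le> C * exp (k * norm x)" for h :: "'a \<Rightarrow> complex" and C k
  proof (intro exI[of _ "\<bar>C\<bar>"] allI impI)
    fix k' :: real and x :: 'a assume "k \<le> k'"
    have "C * exp (k * norm x) \<le> \<bar>C\<bar> * exp (k' * norm x)"
      using \<open>k \<le> k'\<close> by (intro mult_mono) (auto intro: mult_right_mono)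
    with h[of x] show "cmod (h x) \<le> \<bar>C\<bar> * exp (k' * norm x)" by linarith
  qed
  obtain C k D l where f: "\<And>x. cmod (f x) \<le> C * exp (k * norm x)"
    and g: "\<And>x. cmod (g x) \<le> D * exp (l * norm x)"
    using assms unfolding exp_bounded_def by blast
  obtain C' where C': "\<And>k' x. k' \<ge> k \<Longrightarrow> cmod (f x) \<le> C' * exp (k' * norm x)"
    using mono[OF f] by blast
  obtain D' where D': "\<And>k' x. k' \<ge> l \<Longrightarrow> cmod (g x) \<le> D' * exp (k' * norm x)"
    using mono[OF g] by blast
  have "cmod (f x + g x) \<le> (C' + D') * exp (max k l * norm x)" for x
    using norm_triangle_ineq[of "f x" "g x"] C'[of "max k l" x] D'[of "max k l" x]
    by (simp add: distrib_right)
  moreover have "continuous_on UNIV (\<lambda>x. f x + g x)"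
    using assms by (auto simp: exp_bounded_def intro: continuous_intros)
  ultimately show ?thesis unfolding exp_bounded_def by blast
qed

lemma exp_bounded_diff:
  assumes "exp_bounded f" "exp_bounded g"
  shows "exp_bounded (\<lambda>x. f x - g x)"
  using exp_bounded_add[OF assms(1) exp_bounded_mult[OF exp_bounded_const[of "-1"] assms(2)]] by simp

lemma exp_bounded_power: "exp_bounded f \<Longrightarrow> exp_bounded (\<lambda>x. f x ^ n)"
  by (induction n) (simp_all add: exp_bounded_const exp_bounded_mult)

lemma exp_bounded_hermite_poly: "exp_bounded f \<Longrightarrow> exp_bounded (\<lambda>x. hermite_poly m n (f x))"
  by (induction m arbitrary: n)
     (simp_all add: exp_bounded_const exp_bounded_mult exp_bounded_diff exp_bounded_power exp_bounded_cnj)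

lemma exp_bounded_integrable:
  fixes f :: "'a::euclidean_space \<Rightarrow> complex"
  assumes "exp_bounded f"
  shows "integrable lborel (\<lambda>x. f x * of_real (exp (- 2 * (norm x)\<^sup>2)))"
proof -
  obtain C k where C: "\<And>x. cmod (f x) \<le> C * exp (k * norm x)" and cont: "continuous_on UNIV f"
    using assms unfolding exp_bounded_def by blast
  show ?thesis
  proof (rule Bochner_Integration.integrable_bound)
    show "integrable lborel (\<lambda>x::'a. C * (exp (k * norm x) * exp (- 2 * (norm x)\<^sup>2)))"
      by (intro integrable_mult_right integrable_exp_norm_gaussian)
    have [measurable]: "f \<in> borel_measurable borel"
      using cont by (rule borel_measurable_continuous_onI)
    show "(\<lambda>x. f x * of_real (exp (- 2 * (norm x)\<^sup>2))) \<in> borel_measurable lborel"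
      by measurable
    have "cmod (f x) * exp (- 2 * (norm x)\<^sup>2) \<le> \<bar>C * (exp (k * norm x) * exp (- 2 * (norm x)\<^sup>2))\<bar>" for x
      using order_trans[OF mult_right_mono[OF C[of x], of "exp (- 2 * (norm x)\<^sup>2)"] abs_ge_self]
      by (simp add: mult.assoc)
    then show "AE x in lborel. norm (f x * of_real (exp (- 2 * (norm x)\<^sup>2)))
        \<le> norm (C * (exp (k * norm x) * exp (- 2 * (norm x)\<^sup>2)))"
      by (intro always_eventually) (simp add: norm_mult)
  qed
qed

subsection \<open>Orthogonality\<close>

text \<open>Abstracts the inner products of the (m, n) and (p, q) polynomials. Each recurrence moves
  a factor from the right entry to the left one, until \<open>p = q = 0\<close> and
  \<open>zero\<close> applies. It is stated for an arbitrary array because it serves once for each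
  of the two variables.\<close>

lemma hermite_array_eq:
  fixes T :: "nat \<Rightarrow> nat \<Rightarrow> nat \<Rightarrow> nat \<Rightarrow> 'a::{comm_ring_1, semiring_char_0}"
  assumes p: "\<And>m n p q. T m n (Suc p) q
      = T m (Suc n) p q + of_nat m * T (m - 1) n p q - of_nat q * T m n p (q - 1)"
    and q: "\<And>m n p q. T m n p (Suc q)
      = T (Suc m) n p q + of_nat n * T m (n - 1) p q - of_nat p * T m n (p - 1) q"
    and zero: "\<And>m n. (m, n) \<noteq> (0, 0) \<Longrightarrow> T m n 0 0 = 0"
  shows "T m n p q = (if m = p \<and> n = q then fact p * fact q * T 0 0 0 0 else 0)"
proof (induction q arbitrary: m n p)
  case 0
  show ?case
  proof (induction p arbitrary: m n)
    case 0
    then show ?case using zero[of m n] by auto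
  next
    case (Suc p)
    \<comment> \<open>The term with \<open>Suc n\<close> vanishes since its second indices differ;
      the middle one survives only for \<open>m = Suc p\<close> and \<open>n = 0\<close>, and its
      coefficient \<open>m\<close> extends the factorial.\<close>
    show ?case unfolding p[of m n p 0] Suc.IH by (cases m) auto
  qed
next
  case (Suc q)
  \<comment> \<open>When \<open>Suc m = p\<close> and \<open>n = q\<close>, the first and last terms
    have the same value and cancel; the middle term gives the diagonal.\<close>
  show ?case unfolding q[of m n p q] Suc.IH by (cases n; cases p) (auto simp: algebra_simps)
qed

section \<open>The real-linear change of variables to u and v\<close>

definition fst_var :: "complex \<times> complex \<Rightarrow> complex" where
  "fst_var x = fst x + \<i> * snd x"

definition snd_var :: "complex \<times> complex \<Rightarrow> complex" where
  "snd_var x = cnj (fst x) + \<i> * cnj (snd x)"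

lemma bivariate_hermite_eq:
  "bivariate_hermite m n m' n' x = hermite_poly m n (fst_var x) * hermite_poly m' n' (snd_var x)"
  by (simp add: bivariate_hermite_def complex_hermite_eq_hermite_poly fst_var_def snd_var_def split: prod.split)

text \<open>The parallelogram law for z and i w, because \<open>snd_var\<close> is the conjugate of
  z - i w.\<close>

lemma norm_fst_var_snd_var: "(cmod (fst_var x))\<^sup>2 + (cmod (snd_var x))\<^sup>2 = 2 * (norm x)\<^sup>2"
  by (cases x) (simp add: fst_var_def snd_var_def norm_Pair cmod_power2, simp add: power2_eq_square algebra_simps)

lemma exp_bounded_vars: "exp_bounded fst_var" "exp_bounded snd_var"
proof -
  have "bounded_linear fst_var" unfolding fst_var_def[abs_def]
    by (intro bounded_linear_intros)
  then show "exp_bounded fst_var" by (rule exp_bounded_linear)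
  have "bounded_linear snd_var" unfolding snd_var_def[abs_def]
    by (intro bounded_linear_intros bounded_linear_compose[OF bounded_linear_cnj])
  then show "exp_bounded snd_var" by (rule exp_bounded_linear)
qed

lemma exp_bounded_bivariate_hermite: "exp_bounded (bivariate_hermite m n m' n')"
  unfolding bivariate_hermite_eq[abs_def]
  by (intro exp_bounded_mult exp_bounded_hermite_poly exp_bounded_vars)

section \<open>Integration against the Gaussian weight\<close>

lemma gauss_measure_eq: "gauss_measure = density lborel (\<lambda>x. ennreal (exp (- 2 * (norm x)\<^sup>2)))"
proof -
  have "(\<lambda>(z, w). ennreal (exp (- 2 * ((cmod z)\<^sup>2 + (cmod w)\<^sup>2))))
      = (\<lambda>x::complex \<times> complex. ennreal (exp (- 2 * (norm x)\<^sup>2)))"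
    by (auto simp: norm_Pair)
  then show ?thesis by (simp add: gauss_measure_def)
qed

lemma sets_gauss_measure: "sets gauss_measure = sets borel"
  by (simp add: gauss_measure_eq)

lemma exp_norm_integrable_gauss: "integrable gauss_measure (\<lambda>x. exp (k * norm x))"
  unfolding gauss_measure_eq
  using integrable_exp_norm_gaussian[where 'a = "complex \<times> complex", of k]
  by (subst integrable_density) (auto simp: mult.commute)

lemma exp_bounded_measurable: "exp_bounded f \<Longrightarrow> f \<in> borel_measurable borel"
  unfolding exp_bounded_def using borel_measurable_continuous_onI by blast

lemma exp_bounded_integrable_gauss: "exp_bounded f \<Longrightarrow> integrable gauss_measure f"
  unfolding gauss_measure_eq
  using exp_bounded_integrable[of f] exp_bounded_measurable[of f]
  by (subst integrable_density) (auto simp: mult.commute scaleR_conv_of_real)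

lemma exp_bounded_integral_gauss:
  "exp_bounded f \<Longrightarrow> integral\<^sup>L gauss_measure f = (LINT x|lborel. f x * of_real (exp (- 2 * (norm x)\<^sup>2)))"
  unfolding gauss_measure_eq
  using exp_bounded_measurable[of f]
  by (subst integral_density) (auto simp: mult.commute scaleR_conv_of_real)

lemma exp_bounded_L2_space:
  assumes "exp_bounded f"
  shows "f \<in> L2_space gauss_measure"
proof -
  have "integrable gauss_measure (\<lambda>x. f x * cnj (f x))"
    by (intro exp_bounded_integrable_gauss exp_bounded_mult exp_bounded_cnj assms)
  then have "integrable gauss_measure (\<lambda>x. Re (f x * cnj (f x)))" by (rule integrable_Re)
  then have "integrable gauss_measure (\<lambda>x. (cmod (f x))\<^sup>2)"
    by (simp flip: complex_norm_square)
  moreover have "f \<in> borel_measurable gauss_measure"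
    using exp_bounded_measurable[OF assms] measurable_cong_sets[OF sets_gauss_measure refl] by blast
  ultimately show ?thesis by (simp add: L2_space_def)
qed

text \<open>The weight splits into one Gaussian in each variable. This links integrals of the
  polynomials over \<open>gauss_measure\<close> to Lebesgue integrals of derivatives.\<close>

lemma bivariate_hermite_gauss:
  "hermite_gauss m n (fst_var x) * hermite_gauss m' n' (snd_var x)
    = (-1) ^ (m + n + m' + n') * bivariate_hermite m n m' n' x * of_real (exp (- 2 * (norm x)\<^sup>2))"
proof -
  have "complex_of_real (exp (- 2 * (norm x)\<^sup>2))
      = of_real (exp (- (cmod (fst_var x))\<^sup>2)) * of_real (exp (- (cmod (snd_var x))\<^sup>2))"
    using norm_fst_var_snd_var[of x] by (simp flip: of_real_mult exp_add)
  then show ?thesis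
    by (simp add: hermite_gauss_def bivariate_hermite_eq power_add mult_ac)
qed

lemma bivariate_hermite_gauss_integrable:
  "integrable lborel (\<lambda>x. hermite_gauss m n (fst_var x) * hermite_gauss m' n' (snd_var x))"
  unfolding bivariate_hermite_gauss
  by (intro exp_bounded_integrable exp_bounded_mult exp_bounded_const exp_bounded_bivariate_hermite)

lemma bivariate_hermite_gauss_continuous:
  "continuous_on UNIV (\<lambda>x. hermite_gauss m n (fst_var x) * hermite_gauss m' n' (snd_var x))"
  unfolding bivariate_hermite_gauss
  using exp_bounded_bivariate_hermite[of m n m' n'] unfolding exp_bounded_def
  by (intro continuous_intros) auto

text \<open>If some index is positive, the integrand occurs in a directional derivative of a
  function of the same kind, and such derivatives integrate to 0. Varying the direction separates
  the two terms that occur together.\<close>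

lemma bivariate_hermite_gauss_mean:
  assumes "(m, n, m', n') \<noteq> (0, 0, 0, 0)"
  shows "(LINT x|lborel. hermite_gauss m n (fst_var x) * hermite_gauss m' n' (snd_var x)) = 0"
proof -
  define K where "K m n m' n' =
    (LINT x|lborel. hermite_gauss m n (fst_var x) * hermite_gauss m' n' (snd_var x))" for m n m' n'
  have 1: "a * K m (Suc n) m' n' + cnj a * K (Suc m) n m' n' = 0" for a m n m' n'
  proof -
    let ?F' = "\<lambda>x. a * (hermite_gauss m (Suc n) (fst_var x) * hermite_gauss m' n' (snd_var x))
        + cnj a * (hermite_gauss (Suc m) n (fst_var x) * hermite_gauss m' n' (snd_var x))"
    \<comment> \<open>moving along \<open>e\<close> moves \<open>fst_var\<close> along \<open>a\<close> and fixes \<open>snd_var\<close>; below, vice versa\<close>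
    define e where "e = (a / 2, - \<i> * a / 2)"
    have vars: "fst_var (x + t *\<^sub>R e) = fst_var x + of_real t * a" "snd_var (x + t *\<^sub>R e) = snd_var x" for x t
      by (simp_all add: e_def fst_var_def snd_var_def scaleR_conv_of_real algebra_simps)
    have "integral\<^sup>L lborel ?F' = 0"
    proof (rule integral_directional_derivative_eq_0)
      show "((\<lambda>t. hermite_gauss m n (fst_var (x + t *\<^sub>R e)) * hermite_gauss m' n' (snd_var (x + t *\<^sub>R e)))
          has_vector_derivative ?F' (x + t *\<^sub>R e)) (at t)" for x t
        unfolding vars
        by (rule has_vector_derivative_eq_rhs[OF has_vector_derivative_mult_left
              [OF hermite_gauss_has_vector_derivative]]) (simp add: algebra_simps)
    qed (intro continuous_on_add continuous_on_mult_left bivariate_hermite_gauss_continuous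
         Bochner_Integration.integrable_add integrable_mult_right bivariate_hermite_gauss_integrable)+
    then show ?thesis
      by (simp add: K_def bivariate_hermite_gauss_integrable)
  qed
  have 2: "a * K m n m' (Suc n') + cnj a * K m n (Suc m') n' = 0" for a m n m' n'
  proof -
    let ?F' = "\<lambda>x. a * (hermite_gauss m n (fst_var x) * hermite_gauss m' (Suc n') (snd_var x))
        + cnj a * (hermite_gauss m n (fst_var x) * hermite_gauss (Suc m') n' (snd_var x))"
    define e where "e = (cnj a / 2, \<i> * cnj a / 2)"
    have vars: "snd_var (x + t *\<^sub>R e) = snd_var x + of_real t * a" "fst_var (x + t *\<^sub>R e) = fst_var x" for x t
      by (simp_all add: e_def fst_var_def snd_var_def scaleR_conv_of_real algebra_simps)
    have "integral\<^sup>L lborel ?F' = 0"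
    proof (rule integral_directional_derivative_eq_0)
      show "((\<lambda>t. hermite_gauss m n (fst_var (x + t *\<^sub>R e)) * hermite_gauss m' n' (snd_var (x + t *\<^sub>R e)))
          has_vector_derivative ?F' (x + t *\<^sub>R e)) (at t)" for x t
        unfolding vars
        by (rule has_vector_derivative_eq_rhs[OF has_vector_derivative_mult_right
              [OF hermite_gauss_has_vector_derivative]]) (simp add: algebra_simps)
    qed (intro continuous_on_add continuous_on_mult_left bivariate_hermite_gauss_continuous
         Bochner_Integration.integrable_add integrable_mult_right bivariate_hermite_gauss_integrable)+
    then show ?thesis
      by (simp add: K_def bivariate_hermite_gauss_integrable)
  qed
  \<comment> \<open>The choices 1 and i for \<open>a\<close> give u + v = 0 and u - v = 0.\<close>
  have both_0: "u = 0 \<and> v = 0" if "\<And>a. a * u + cnj a * v = 0" for u v :: complex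
    using that[of 1] that[of \<i>] by (simp add: algebra_simps)
  have "K m n m' n' = 0"
    using assms both_0[OF 1] both_0[OF 2]
    by (cases m; cases n; cases m'; cases n') auto
  then show ?thesis by (simp add: K_def)
qed

text \<open>Linearity of the integral in exactly the shape of the three-term recurrences used for
  the inner products.\<close>

lemma integral_gauss_combination:
  assumes "exp_bounded a" "exp_bounded b" "exp_bounded c"
    and "\<And>x. f x = a x + k * b x - l * c x"
  shows "integral\<^sup>L gauss_measure f
    = integral\<^sup>L gauss_measure a + k * integral\<^sup>L gauss_measure b - l * integral\<^sup>L gauss_measure c"
proof -
  have "f = (\<lambda>x. a x + k * b x - l * c x)" using assms(4) by blast
  then show ?thesis
    using assms(1-3)[THEN exp_bounded_integrable_gauss] by simp
qed

text \<open>Raising an index on the conjugated side costs a factor \<open>cnj z\<close> or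
  \<open>z\<close>, which the recurrences then absorb into the other side. These are the two
  hypotheses of \<open>hermite_array_eq\<close> before integration.\<close>

lemma hermite_poly_cnj_hermite_poly_Suc:
  "hermite_poly m n z * cnj (hermite_poly (Suc p) q z) = hermite_poly m (Suc n) z * cnj (hermite_poly p q z)
    + of_nat m * (hermite_poly (m - 1) n z * cnj (hermite_poly p q z)) - of_nat q * (hermite_poly m n z * cnj (hermite_poly p (q - 1) z))"
  "hermite_poly m n z * cnj (hermite_poly p (Suc q) z) = hermite_poly (Suc m) n z * cnj (hermite_poly p q z)
    + of_nat n * (hermite_poly m (n - 1) z * cnj (hermite_poly p q z)) - of_nat p * (hermite_poly m n z * cnj (hermite_poly (p - 1) q z))"
proof -
  have Suc_right: "hermite_poly m (Suc n) z = cnj z * hermite_poly m n z - of_nat m * hermite_poly (m - 1) n z" for m n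
    using cnj_mult_hermite_poly[of z m n] by simp
  show "hermite_poly m n z * cnj (hermite_poly (Suc p) q z) = hermite_poly m (Suc n) z * cnj (hermite_poly p q z)
    + of_nat m * (hermite_poly (m - 1) n z * cnj (hermite_poly p q z)) - of_nat q * (hermite_poly m n z * cnj (hermite_poly p (q - 1) z))"
    unfolding Suc_right by (simp add: algebra_simps)
  show "hermite_poly m n z * cnj (hermite_poly p (Suc q) z) = hermite_poly (Suc m) n z * cnj (hermite_poly p q z)
    + of_nat n * (hermite_poly m (n - 1) z * cnj (hermite_poly p q z)) - of_nat p * (hermite_poly m n z * cnj (hermite_poly (p - 1) q z))"
    unfolding Suc_right by (simp add: algebra_simps)
qed

text \<open>Ensures that the basis functions have nonzero norm; the value of the total mass is never
  computed.\<close>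

lemma gauss_measure_total_nonzero: "integral\<^sup>L gauss_measure (\<lambda>x. 1 :: complex) \<noteq> 0"
proof
  let ?w = "\<lambda>x::complex \<times> complex. exp (- 2 * (norm x)\<^sup>2)"
  assume "integral\<^sup>L gauss_measure (\<lambda>x. 1 :: complex) = 0"
  then have "integral\<^sup>L lborel ?w = 0"
    using exp_bounded_integral_gauss[OF exp_bounded_const[of 1]] by simp
  moreover have "integrable lborel ?w"
    using integrable_exp_norm_gaussian[of 0, where 'a = "complex \<times> complex"] by simp
  ultimately have "AE x in lborel. ?w x = 0"
    by (subst (asm) integral_nonneg_eq_0_iff_AE) auto
  then have "AE x in (lborel :: (complex \<times> complex) measure). False" by simp
  then show False by (simp add: AE_iff_measurable[OF _ refl])
qed

text \<open>\<open>hermite_array_eq\<close> is applied twice: in the indices belonging to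
  \<open>fst_var\<close> with the others fixed, then in those belonging to
  \<open>snd_var\<close>.\<close>

lemma bivariate_hermite_inner:
  "L2_inner gauss_measure (bivariate_hermite m n m' n') (bivariate_hermite p q p' q')
    = (if (m, n, m', n') = (p, q, p', q')
       then fact p * fact q * fact p' * fact q' * integral\<^sup>L gauss_measure (\<lambda>x. 1) else 0)"
proof -
  \<comment> \<open>The indices are regrouped by variable instead of by factor of the inner product,
    to match the arrays.\<close>
  define S where "S m n p q m' n' p' q' =
    L2_inner gauss_measure (bivariate_hermite m n m' n') (bivariate_hermite p q p' q')"
    for m n p q m' n' p' q'
  have S: "S m n p q m' n' p' q' = (LINT x|gauss_measure. (hermite_poly m n (fst_var x) * cnj (hermite_poly p q (fst_var x)))
      * (hermite_poly m' n' (snd_var x) * cnj (hermite_poly p' q' (snd_var x))))" for m n p q m' n' p' q'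
    by (simp add: S_def L2_inner_def bivariate_hermite_eq mult_ac)
  note bounded = exp_bounded_mult exp_bounded_cnj exp_bounded_hermite_poly exp_bounded_vars
  have fst_rec:
    "S m n (Suc p) q m' n' p' q' = S m (Suc n) p q m' n' p' q' + of_nat m * S (m - 1) n p q m' n' p' q'
      - of_nat q * S m n p (q - 1) m' n' p' q'"
    "S m n p (Suc q) m' n' p' q' = S (Suc m) n p q m' n' p' q' + of_nat n * S m (n - 1) p q m' n' p' q'
      - of_nat p * S m n (p - 1) q m' n' p' q'" for m n p q m' n' p' q'
    unfolding S
    by (rule integral_gauss_combination; (intro bounded)?;
        simp only: hermite_poly_cnj_hermite_poly_Suc; simp only: algebra_simps)+
  have snd_rec:
    "S m n p q m' n' (Suc p') q' = S m n p q m' (Suc n') p' q' + of_nat m' * S m n p q (m' - 1) n' p' q'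
      - of_nat q' * S m n p q m' n' p' (q' - 1)"
    "S m n p q m' n' p' (Suc q') = S m n p q (Suc m') n' p' q' + of_nat n' * S m n p q m' (n' - 1) p' q'
      - of_nat p' * S m n p q m' n' (p' - 1) q'" for m n p q m' n' p' q'
    unfolding S
    by (rule integral_gauss_combination; (intro bounded)?;
        simp only: hermite_poly_cnj_hermite_poly_Suc; simp only: algebra_simps)+
  have mean: "S m n 0 0 m' n' 0 0 = 0" if "(m, n, m', n') \<noteq> (0, 0, 0, 0)" for m n m' n'
  proof -
    have "S m n 0 0 m' n' 0 0 = (LINT x|gauss_measure. bivariate_hermite m n m' n' x)"
      by (simp add: S bivariate_hermite_eq)
    also have "\<dots> = (LINT x|lborel. bivariate_hermite m n m' n' x * of_real (exp (- 2 * (norm x)\<^sup>2)))"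
      by (rule exp_bounded_integral_gauss[OF exp_bounded_bivariate_hermite])
    finally have "(-1) ^ (m + n + m' + n') * S m n 0 0 m' n' 0 0
        = (LINT x|lborel. hermite_gauss m n (fst_var x) * hermite_gauss m' n' (snd_var x))"
      unfolding bivariate_hermite_gauss by (simp only: mult.assoc integral_mult_right_zero)
    then show ?thesis using bivariate_hermite_gauss_mean[OF that] by simp
  qed
  have "S m n p q m' n' p' q'
      = (if m = p \<and> n = q then fact p * fact q * S 0 0 0 0 m' n' p' q' else 0)"
  proof (rule hermite_array_eq[where T = "\<lambda>m n p q. S m n p q m' n' p' q'"])
    \<comment> \<open>The vanishing hypothesis for the first variable is itself obtained from the
      array lemma in the second variable, since \<open>mean\<close> covers only zero indices on the
      right.\<close>
    fix m n :: nat assume "(m, n) \<noteq> (0, 0)"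
    then have "S m n 0 0 m' n' 0 0 = 0" for m' n' by (intro mean) auto
    then show "S m n 0 0 m' n' p' q' = 0"
      using hermite_array_eq[where T = "S m n 0 0", OF snd_rec, of m' n' p' q'] by simp
  qed (rule fst_rec)+
  moreover have "S 0 0 0 0 m' n' p' q'
      = (if m' = p' \<and> n' = q' then fact p' * fact q' * S 0 0 0 0 0 0 0 0 else 0)"
    by (rule hermite_array_eq[where T = "S 0 0 0 0", OF snd_rec]) (use mean in auto)
  moreover have "S 0 0 0 0 0 0 0 0 = integral\<^sup>L gauss_measure (\<lambda>x. 1)"
    by (simp add: S)
  ultimately show ?thesis by (auto simp: S_def)
qed

subsection \<open>Completeness\<close>

text \<open>The inductive form gives the closure properties directly;
  \<open>lin_span_finite_sum\<close> recovers explicit finite combinations.\<close>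

inductive_set lin_span :: "('i \<Rightarrow> 'a \<Rightarrow> complex) \<Rightarrow> ('a \<Rightarrow> complex) set" for \<phi> where
  base: "\<phi> i \<in> lin_span \<phi>"
| add: "f \<in> lin_span \<phi> \<Longrightarrow> g \<in> lin_span \<phi> \<Longrightarrow> (\<lambda>x. f x + g x) \<in> lin_span \<phi>"
| scale: "f \<in> lin_span \<phi> \<Longrightarrow> (\<lambda>x. c * f x) \<in> lin_span \<phi>"

lemma lin_span_finite_sum:
  assumes "f \<in> lin_span \<phi>"
  shows "\<exists>F c. finite F \<and> f = (\<lambda>x. \<Sum>i\<in>F. c i * \<phi> i x)"
  using assms
proof induction
  case (base i)
  show ?case by (rule exI[of _ "{i}"], rule exI[of _ "\<lambda>_. 1"]) simp
next
  case (add f g)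
  then obtain F c G d where F: "finite F" "f = (\<lambda>x. \<Sum>i\<in>F. c i * \<phi> i x)"
    and G: "finite G" "g = (\<lambda>x. \<Sum>i\<in>G. d i * \<phi> i x)" by blast
  \<comment> \<open>Both coefficient families are extended by 0 to the union of the index
    sets.\<close>
  let ?c = "\<lambda>i. (if i \<in> F then c i else 0) + (if i \<in> G then d i else 0)"
  have "(\<Sum>i\<in>F. c i * \<phi> i x) = (\<Sum>i\<in>F \<union> G. (if i \<in> F then c i else 0) * \<phi> i x)" for x
    using F(1) G(1) by (intro sum.mono_neutral_cong_left) auto
  moreover have "(\<Sum>i\<in>G. d i * \<phi> i x) = (\<Sum>i\<in>F \<union> G. (if i \<in> G then d i else 0) * \<phi> i x)" for x
    using F(1) G(1) by (intro sum.mono_neutral_cong_left) auto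
  ultimately have "(\<lambda>x. f x + g x) = (\<lambda>x. \<Sum>i\<in>F \<union> G. ?c i * \<phi> i x)"
    by (simp add: F(2) G(2) distrib_right sum.distrib)
  then show ?case using F(1) G(1) by (intro exI[of _ "F \<union> G"] exI[of _ ?c]) simp
next
  case (scale f c)
  then obtain F d where F: "finite F" "f = (\<lambda>x. \<Sum>i\<in>F. d i * \<phi> i x)" by blast
  then show ?case
    by (intro exI[of _ F] exI[of _ "\<lambda>i. c * d i"]) (simp add: sum_distrib_left mult.assoc)
qed

abbreviation (input) hermite_family :: "nat \<times> nat \<times> nat \<times> nat \<Rightarrow> complex \<times> complex \<Rightarrow> complex" where
  "hermite_family \<equiv> \<lambda>(m, n, m', n'). bivariate_hermite m n m' n'"

lemma lin_span_hermite: "bivariate_hermite m n m' n' \<in> lin_span hermite_family"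
  using lin_span.base[of hermite_family "(m, n, m', n')"] by simp

text \<open>By linearity it suffices to multiply a single basis function, where each recurrence
  yields two basis functions. A truncated index such as \<open>n - 1\<close> at 0 comes with
  coefficient 0.\<close>

lemma var_mult_hermite_span:
  assumes "f \<in> lin_span hermite_family"
  shows "(\<lambda>x. fst_var x * f x) \<in> lin_span hermite_family"
    and "(\<lambda>x. cnj (fst_var x) * f x) \<in> lin_span hermite_family"
    and "(\<lambda>x. snd_var x * f x) \<in> lin_span hermite_family"
    and "(\<lambda>x. cnj (snd_var x) * f x) \<in> lin_span hermite_family"
proof -
  have step: "(\<lambda>x. v x * f x) \<in> lin_span hermite_family"
    if v: "\<And>m n m' n'. (\<lambda>x. v x * bivariate_hermite m n m' n' x) \<in> lin_span hermite_family" for v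
    using assms
  proof induction
    case (base i)
    then show ?case using v by (cases i) simp
  next
    case (add f g)
    from lin_span.add[OF add.IH] show ?case by (simp add: distrib_left)
  next
    case (scale f c)
    from lin_span.scale[OF scale.IH, of c] show ?case by (simp add: mult.left_commute)
  qed
  have comb: "(\<lambda>x. v x * bivariate_hermite m n m' n' x) \<in> lin_span hermite_family"
    if "\<And>x. v x * bivariate_hermite m n m' n' x = bivariate_hermite a b a' b' x + k * bivariate_hermite c d c' d' x"
    for v m n m' n' a b a' b' c d c' d' k
    unfolding that by (intro lin_span.intros lin_span_hermite)
  show "(\<lambda>x. fst_var x * f x) \<in> lin_span hermite_family"
  proof (rule step, rule comb)
    show "fst_var x * bivariate_hermite m n m' n' x =
        bivariate_hermite (Suc m) n m' n' x + of_nat n * bivariate_hermite m (n - 1) m' n' x" for m n m' n' x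
      by (simp add: bivariate_hermite_eq algebra_simps)
  qed
  show "(\<lambda>x. snd_var x * f x) \<in> lin_span hermite_family"
  proof (rule step, rule comb)
    show "snd_var x * bivariate_hermite m n m' n' x =
        bivariate_hermite m n (Suc m') n' x + of_nat n' * bivariate_hermite m n m' (n' - 1) x" for m n m' n' x
      by (simp add: bivariate_hermite_eq algebra_simps)
  qed
  show "(\<lambda>x. cnj (fst_var x) * f x) \<in> lin_span hermite_family"
  proof (rule step, rule comb)
    show "cnj (fst_var x) * bivariate_hermite m n m' n' x =
        bivariate_hermite m (Suc n) m' n' x + of_nat m * bivariate_hermite (m - 1) n m' n' x" for m n m' n' x
      unfolding bivariate_hermite_eq mult.assoc[symmetric] cnj_mult_hermite_poly by (simp add: algebra_simps)
  qed
  show "(\<lambda>x. cnj (snd_var x) * f x) \<in> lin_span hermite_family"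
  proof (rule step, rule comb)
    show "cnj (snd_var x) * bivariate_hermite m n m' n' x =
        bivariate_hermite m n m' (Suc n') x + of_nat m' * bivariate_hermite m n (m' - 1) n' x" for m n m' n' x
      unfolding bivariate_hermite_eq mult.left_commute[of "cnj (snd_var x)"] cnj_mult_hermite_poly
      by (simp add: algebra_simps)
  qed
qed

lemma exp_bounded_hermite_span: "f \<in> lin_span hermite_family \<Longrightarrow> exp_bounded f"
  by (induction rule: lin_span.induct)
     (auto intro: exp_bounded_bivariate_hermite exp_bounded_add exp_bounded_mult exp_bounded_const)

lemma hermite_polynomial_subspace: "polynomial_subspace gauss_measure (lin_span hermite_family)"
proof
  show "lin_span hermite_family \<subseteq> L2_space gauss_measure"
    using exp_bounded_hermite_span exp_bounded_L2_space by blast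
  show "(\<lambda>x. 1) \<in> lin_span hermite_family"
    using lin_span_hermite[of 0 0 0 0] unfolding bivariate_hermite_eq[abs_def] by simp
  show "(\<lambda>x. of_real (x \<bullet> \<xi>) * p x) \<in> lin_span hermite_family" if p: "p \<in> lin_span hermite_family" for p \<xi>
  proof -
    obtain a b where ab: "\<xi> = (a, b)" by (cases \<xi>)
    \<comment> \<open>With u and v for the two variables, z = (u + cnj v)/2 and w = (u - cnj
      v)/(2i). Substituting into the real part of z cnj a + w cnj b gives \<open>c\<close> as
      coefficient of u and \<open>d\<close> as coefficient of cnj v; their conjugates come from
      taking the real part.\<close>
    define c d where "c = (cnj a - \<i> * cnj b) / 4" and "d = (cnj a + \<i> * cnj b) / 4"
    have inner: "complex_of_real (x \<bullet> \<xi>) = c * fst_var x + cnj c * cnj (fst_var x)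
        + cnj d * snd_var x + d * cnj (snd_var x)" for x
      by (cases x) (simp add: complex_eq_iff ab c_def d_def fst_var_def snd_var_def inner_complex_def
          algebra_simps add_divide_distrib diff_divide_distrib)
    have "(\<lambda>x. (c * (fst_var x * p x) + cnj c * (cnj (fst_var x) * p x)
        + cnj d * (snd_var x * p x) + d * (cnj (snd_var x) * p x))) \<in> lin_span hermite_family"
      by (intro lin_span.add lin_span.scale var_mult_hermite_span p)
    then show ?thesis unfolding inner by (simp add: algebra_simps)
  qed
qed (rule lin_span.intros sets_gauss_measure exp_norm_integrable_gauss; assumption?)+

theorem theorem3p2:
  "L2_orthogonal_basis gauss_measure (\<lambda>(m, n, m', n'). bivariate_hermite m n m' n')"
  unfolding L2_orthogonal_basis_def
proof (intro conjI allI impI ballI)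
  fix i :: "nat \<times> nat \<times> nat \<times> nat"
  obtain m n m' n' where i: "i = (m, n, m', n')" by (cases i)
  let ?f = "bivariate_hermite m n m' n'"
  show "hermite_family i \<in> L2_space gauss_measure"
    by (simp add: i exp_bounded_L2_space exp_bounded_bivariate_hermite)
  \<comment> \<open>The squared norm is the diagonal inner product: factorials times the nonzero
    total mass.\<close>
  have "complex_of_real (LINT x|gauss_measure. (cmod (?f x))\<^sup>2) = L2_inner gauss_measure ?f ?f"
    unfolding L2_inner_def complex_norm_square[symmetric] by (rule integral_complex_of_real[symmetric])
  also have "\<dots> \<noteq> 0"
    using gauss_measure_total_nonzero by (simp add: bivariate_hermite_inner)
  finally show "L2_norm gauss_measure (hermite_family i) \<noteq> 0"
    by (simp add: i L2_norm_def)
next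
  fix i j :: "nat \<times> nat \<times> nat \<times> nat"
  assume "i \<noteq> j"
  then show "L2_inner gauss_measure (hermite_family i) (hermite_family j) = 0"
    by (cases i; cases j) (auto simp: bivariate_hermite_inner)
next
  interpret polynomial_subspace gauss_measure "lin_span hermite_family"
    by (rule hermite_polynomial_subspace)
  fix f and \<epsilon> :: real
  assume "f \<in> L2_space gauss_measure" "\<epsilon> > 0"
  \<comment> \<open>The closure is defined by squared distances, hence the tolerance
    \<open>\<epsilon>\<^sup>2\<close>.\<close>
  then have "f \<in> L2_closure gauss_measure (lin_span hermite_family)" "\<epsilon>\<^sup>2 > 0"
    by (simp_all add: polynomials_dense)
  then obtain p where p: "p \<in> lin_span hermite_family"
    "(LINT x|gauss_measure. (cmod (f x - p x))\<^sup>2) < \<epsilon>\<^sup>2"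
    unfolding L2_closure_def by blast
  obtain F c where F: "finite F" "p = (\<lambda>x. \<Sum>i\<in>F. c i * hermite_family i x)"
    using lin_span_finite_sum[OF p(1)] by blast
  have "L2_norm gauss_measure (\<lambda>x. f x - p x) < \<epsilon>"
    using p(2) \<open>\<epsilon> > 0\<close> unfolding L2_norm_def by (simp add: real_less_lsqrt)
  then show "\<exists>F c. finite F \<and>
      L2_norm gauss_measure (\<lambda>x. f x - (\<Sum>i\<in>F. c i * hermite_family i x)) < \<epsilon>"
    using F by blast
qed

end
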